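(* Two injective PEPS defined on the same graph, where the graph does not contain double edges and self-loops, generate the same state if and only if the generating tensors are related by a gauge transformation. The matrices defining the gauge transformation are unique up to a multiplicative constant.
   Context: A PEPS on a finite graph assigns to each edge $e$ a finite-dimensional bond space $V_e$ (with a fixed orientation of $e$) and to each vertex $s$ a tensor $A_s$ with one physical index (in a finite-dimensional space $\mathcal H_s$) and one virtual index for each edge incident to $s$ (in $V_e$ or $V_e^*$ according to orientation). The state it generates, in $\bigotimes_s\mathcal H_s$, is obtained by contracting, for every edge, the two virtual indices at its ends. The two PEPS have the same physical spaces; translation invariance is not assumed. A tensor is injective if it is injective as a linear map from its virtual space (the tensor product of the spaces of its virtual indices) to its physical space; a PEPS is injective if all its tensors are. The tensors $(A_s)$ and $(B_s)$ are related by a gauge transformation if there is an invertible matrix $Z_e$ for each edge $e$ (between the corresponding bond spaces) such that for every vertex $s$, $B_s$ is obtained from $A_s$ by applying to each virtual index the matrix $Z_e$ if $s$ is the first endpoint of $e$, and $Z_e^{-1}$ if $s$ is the second endpoint, so that $Z_e$ and $Z_e^{-1}$ cancel when the edge $e$ is contracted.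
   Formalization: The graph is assumed connected for "same state implies gauge related" (false on every disconnected graph: rescale two components by 2 and 1/2), all bond spaces are assumed nonzero, and uniqueness is up to one nonzero constant per edge. *)

theory Defs
  imports
    Complex_Main
    "HOL-Library.FuncSet"
    "Graph_Theory.Digraph_Component"
    "Jordan_Normal_Form.Gauss_Jordan_Elimination"
begin

text \<open>
  A finite graph is a finite digraph \<open>G\<close> of the library; the arc \<open>e\<close> is an edge with its fixed
  orientation, first endpoint \<open>tail G e\<close> and second endpoint \<open>head G e\<close>.

  All spaces are given in coordinates: the bond space of \<open>e\<close> is \<open>\<complex>\<^sup>D\<close> with \<open>D = D e\<close> (or its dual,
  in dual coordinates), the physical space of \<open>s\<close> is \<open>\<complex>\<^sup>d\<close> with \<open>d = d s\<close>. A tensor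
  \<open>A s :: nat \<Rightarrow> ('e \<Rightarrow> nat) \<Rightarrow> complex\<close> maps a physical index and a choice of
  one virtual index for every edge incident to \<open>s\<close> to a coefficient; only its values at
  indices within the dimensions carry meaning. One index per incident edge is the right
  count because self-loops are excluded.
\<close>

type_synonym 'e tensor = "nat \<Rightarrow> ('e \<Rightarrow> nat) \<Rightarrow> complex"

definition incident :: "('v, 'e) pre_digraph \<Rightarrow> 'v \<Rightarrow> 'e set" where
  "incident G s = {e \<in> arcs G. tail G e = s \<or> head G e = s}"

definition virtual_indices :: "('v, 'e) pre_digraph \<Rightarrow> ('e \<Rightarrow> nat) \<Rightarrow> 'v \<Rightarrow> ('e \<Rightarrow> nat) set" where
  "virtual_indices G D s = (\<Pi>\<^sub>E e\<in>incident G s. {..<D e})"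

text \<open>
  The contraction of edge \<open>e\<close> is the sum over the common value \<open>w e\<close> of the two
  virtual indices at its ends. The result is a function of the joint physical index,
  i.e. the coordinates of a vector in the tensor product of the physical spaces.
\<close>

definition peps_state ::
  "('v, 'e) pre_digraph \<Rightarrow> ('v \<Rightarrow> nat) \<Rightarrow> ('e \<Rightarrow> nat) \<Rightarrow> ('v \<Rightarrow> 'e tensor) \<Rightarrow> ('v \<Rightarrow> nat) \<Rightarrow> complex" where
  "peps_state G d D A =
     (\<lambda>p \<in> (\<Pi>\<^sub>E s\<in>verts G. {..<d s}).
        \<Sum>w \<in> (\<Pi>\<^sub>E e\<in>arcs G. {..<D e}).
          \<Prod>s\<in>verts G. A s (p s) (restrict w (incident G s)))"

text \<open>The tensor at \<open>s\<close> as a linear map from its virtual space to its physical space, in coordinates.\<close>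

definition tensor_map ::
  "('v, 'e) pre_digraph \<Rightarrow> ('v \<Rightarrow> nat) \<Rightarrow> ('e \<Rightarrow> nat) \<Rightarrow> ('v \<Rightarrow> 'e tensor) \<Rightarrow> 'v \<Rightarrow>
     (('e \<Rightarrow> nat) \<Rightarrow> complex) \<Rightarrow> nat \<Rightarrow> complex" where
  "tensor_map G d D A s X = (\<lambda>i\<in>{..<d s}. \<Sum>v\<in>virtual_indices G D s. A s i v * X v)"

definition injective_peps ::
  "('v, 'e) pre_digraph \<Rightarrow> ('v \<Rightarrow> nat) \<Rightarrow> ('e \<Rightarrow> nat) \<Rightarrow> ('v \<Rightarrow> 'e tensor) \<Rightarrow> bool" where
  "injective_peps G d D A \<longleftrightarrow>
     (\<forall>s\<in>verts G. inj_on (tensor_map G d D A s) (virtual_indices G D s \<rightarrow>\<^sub>E UNIV))"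

text \<open>
  \<open>Z e\<close> maps the bond space of \<open>e\<close> in the first PEPS to the one in the second. At the second
  endpoint the index is dual, so there the inverse is contracted from the other side.
  For an invertible matrix, \<open>mat_inverse\<close> returns \<open>Some\<close> of its inverse.
\<close>

definition gauge_action ::
  "('v, 'e) pre_digraph \<Rightarrow> ('e \<Rightarrow> nat) \<Rightarrow> ('e \<Rightarrow> complex mat) \<Rightarrow> ('v \<Rightarrow> 'e tensor) \<Rightarrow> 'v \<Rightarrow> 'e tensor" where
  "gauge_action G D Z A s i w =
     (\<Sum>v\<in>virtual_indices G D s.
        (\<Prod>e\<in>incident G s.
           if tail G e = s then Z e $$ (w e, v e)
           else the (mat_inverse (Z e)) $$ (v e, w e)) * A s i v)"

text \<open>
  Invertibility includes squareness, so a gauge transformation can only exist if the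
  bond dimensions \<open>D e\<close> and \<open>D' e\<close> agree.
\<close>

definition is_gauge ::
  "('v, 'e) pre_digraph \<Rightarrow> ('v \<Rightarrow> nat) \<Rightarrow> ('e \<Rightarrow> nat) \<Rightarrow> ('v \<Rightarrow> 'e tensor) \<Rightarrow>
     ('e \<Rightarrow> nat) \<Rightarrow> ('v \<Rightarrow> 'e tensor) \<Rightarrow> ('e \<Rightarrow> complex mat) \<Rightarrow> bool" where
  "is_gauge G d D A D' B Z \<longleftrightarrow>
     (\<forall>e\<in>arcs G. Z e \<in> carrier_mat (D' e) (D e) \<and> invertible_mat (Z e)) \<and>
     (\<forall>s\<in>verts G. \<forall>i<d s. \<forall>w\<in>virtual_indices G D' s. B s i w = gauge_action G D Z A s i w)"

definition gauge_related ::
  "('v, 'e) pre_digraph \<Rightarrow> ('v \<Rightarrow> nat) \<Rightarrow> ('e \<Rightarrow> nat) \<Rightarrow> ('v \<Rightarrow> 'e tensor) \<Rightarrow>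
     ('e \<Rightarrow> nat) \<Rightarrow> ('v \<Rightarrow> 'e tensor) \<Rightarrow> bool" where
  "gauge_related G d D A D' B \<longleftrightarrow> (\<exists>Z. is_gauge G d D A D' B Z)"

end

theory Submission
  imports Defs
begin

text \<open>
  Injectivity provides left inverses \<open>a s\<close> of \<open>A s\<close> and \<open>b s\<close> of \<open>B s\<close>. Applying \<open>a\<close> to equal states
  at all vertices except \<open>s\<close> shows that \<open>A s\<close> and \<open>B s\<close> have the same range, so \<open>B s = A s \<circ> M s\<close>
  with \<open>M s = a s \<circ> B s\<close> invertible and inverse \<open>N s = b s \<circ> A s\<close>.

  For an edge \<open>e\<close> with ends \<open>s\<close> and \<open>t\<close>, apply \<open>b t\<close> at \<open>t\<close> and \<open>a\<close> at all other vertices. Since no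
  other edge joins \<open>s\<close> to \<open>t\<close>, the virtual indices of \<open>s\<close> off \<open>e\<close> can be prescribed independently of
  those of \<open>t\<close>, and this yields \<open>M s \<circ> (1 \<otimes> Y) = n \<otimes> 1\<close> with \<open>n\<close> acting on the bond space of \<open>e\<close> and
  \<open>n \<noteq> 0\<close>. Together with the same relation for \<open>N s\<close> this forces \<open>M s = n \<otimes> m\<close>. Doing so for all edges
  at \<open>s\<close>, \<open>M s\<close> is a scalar \<open>C s\<close> times a product of edge matrices that are mutually inverse at the two
  ends of each edge, and the product of all \<open>C s\<close> is \<open>1\<close>. On a connected graph such scalars are absorbed
  by rescaling the edge matrices.
\<close>

subsection \<open>Dual families and tensor factorization\<close>

text \<open>Columns that admit only the trivial relation have a left inverse over any field. The
  induction is over the columns: a functional vanishing on the old columns but not on the new one is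
  built first, and the old dual functionals are then corrected by multiples of it.\<close>

lemma dual_family:
  fixes A :: "'i \<Rightarrow> 'v \<Rightarrow> 'a::field"
  assumes "finite V" "finite I"
    and "\<And>X. (\<And>i. i \<in> I \<Longrightarrow> (\<Sum>v\<in>V. A i v * X v) = 0) \<Longrightarrow> (\<And>v. v \<in> V \<Longrightarrow> X v = 0)"
  shows "\<exists>a. \<forall>u\<in>V. \<forall>v\<in>V. (\<Sum>i\<in>I. a u i * A i v) = (if u = v then 1 else 0)"
  using assms(1,3)
proof (induction V)
  case empty
  then show ?case by simp
next
  case (insert v0 V)
  have indep: "\<And>X v. (\<And>i. i \<in> I \<Longrightarrow> (\<Sum>v\<in>V. A i v * X v) = 0) \<Longrightarrow> v \<in> V \<Longrightarrow> X v = 0"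
  proof -
    fix X v assume X: "\<And>i. i \<in> I \<Longrightarrow> (\<Sum>v\<in>V. A i v * X v) = 0" and v: "v \<in> V"
    let ?X = "X(v0 := 0)"
    have "(\<Sum>v\<in>insert v0 V. A i v * ?X v) = 0" if "i \<in> I" for i
    proof -
      have "(\<Sum>v\<in>V. A i v * ?X v) = (\<Sum>v\<in>V. A i v * X v)"
        using insert.hyps by (intro sum.cong) auto
      then show ?thesis using X[OF that] insert.hyps by simp
    qed
    then have "?X v = 0" using insert.prems[of ?X v] v by blast
    then show "X v = 0" using v insert.hyps by (auto split: if_splits)
  qed
  have "\<exists>a. \<forall>u\<in>V. \<forall>v\<in>V. (\<Sum>i\<in>I. a u i * A i v) = (if u = v then 1 else 0)"
    by (rule insert.IH) (rule indep)
  then obtain a where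
    a: "\<And>u v. u \<in> V \<Longrightarrow> v \<in> V \<Longrightarrow> (\<Sum>i\<in>I. a u i * A i v) = (if u = v then 1 else 0)" by blast
  \<comment> \<open>\<open>c\<close> holds the coefficients that the old dual functionals assign to
    the new column, and \<open>r\<close> is what remains of that column after subtracting the
    combination of old columns that they predict.\<close>
  define c where "c v = (\<Sum>i\<in>I. a v i * A i v0)" for v
  define r where "r i = A i v0 - (\<Sum>v\<in>V. A i v * c v)" for i
  have "\<exists>i0\<in>I. r i0 \<noteq> 0"
  proof (rule ccontr)
    assume *: "\<not> ?thesis"
    \<comment> \<open>If \<open>r\<close> vanished, the new column would be a combination of the old
      ones, and \<open>?X\<close> would be a nontrivial relation.\<close>
    let ?X = "\<lambda>v. if v = v0 then 1 else - c v"
    have "(\<Sum>v\<in>insert v0 V. A i v * ?X v) = 0" if "i \<in> I" for i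
    proof -
      have "(\<Sum>v\<in>V. A i v * ?X v) = - (\<Sum>v\<in>V. A i v * c v)"
        unfolding sum_negf[symmetric] using insert.hyps by (intro sum.cong) auto
      then show ?thesis using * that insert.hyps by (simp add: r_def)
    qed
    then have "?X v0 = 0" using insert.prems[of ?X v0] by blast
    then show False by simp
  qed
  then obtain i0 where i0: "i0 \<in> I" "r i0 \<noteq> 0" by blast
  \<comment> \<open>\<open>\<phi>\<close> takes the coordinate \<open>i0\<close> of what remains of
    a vector after subtracting its predicted combination of old columns; it kills every old column
    and takes the value \<open>r i0\<close> on the new one.\<close>
  define \<phi> where "\<phi> i = (if i = i0 then 1 else 0) - (\<Sum>v\<in>V. A i0 v * a v i)" for i
  have \<phi>: "(\<Sum>i\<in>I. \<phi> i * f i) = f i0 - (\<Sum>v\<in>V. A i0 v * (\<Sum>i\<in>I. a v i * f i))" for f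
  proof -
    have "(\<Sum>i\<in>I. \<phi> i * f i) = (\<Sum>i\<in>I. (if i = i0 then f i else 0)) - (\<Sum>i\<in>I. \<Sum>v\<in>V. A i0 v * a v i * f i)"
      unfolding sum_subtractf[symmetric] \<phi>_def
      by (intro sum.cong refl) (simp add: left_diff_distrib sum_distrib_right)
    also have "(\<Sum>i\<in>I. \<Sum>v\<in>V. A i0 v * a v i * f i) = (\<Sum>v\<in>V. A i0 v * (\<Sum>i\<in>I. a v i * f i))"
      by (subst sum.swap) (simp add: sum_distrib_left mult.assoc)
    finally show ?thesis using i0 assms(2) by (simp add: sum.delta)
  qed
  have \<phi>V: "(\<Sum>i\<in>I. \<phi> i * A i v) = 0" if "v \<in> V" for v
  proof -
    have "(\<Sum>u\<in>V. A i0 u * (\<Sum>i\<in>I. a u i * A i v)) = (\<Sum>u\<in>V. if u = v then A i0 v else 0)"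
      using that by (intro sum.cong) (auto simp: a)
    then show ?thesis using that insert.hyps by (simp add: \<phi> sum.delta)
  qed
  have \<phi>0: "(\<Sum>i\<in>I. \<phi> i * A i v0) = r i0"
    by (simp add: \<phi> r_def c_def)
  define a' where "a' u i = (if u = v0 then \<phi> i / r i0 else a u i - c u * \<phi> i / r i0)" for u i
  have *: "(\<Sum>i\<in>I. a' u i * f i) = (if u = v0 then (\<Sum>i\<in>I. \<phi> i * f i) / r i0
     else (\<Sum>i\<in>I. a u i * f i) - c u * (\<Sum>i\<in>I. \<phi> i * f i) / r i0)" for u f
    by (simp add: a'_def sum_divide_distrib left_diff_distrib sum_subtractf sum_distrib_left mult.assoc)
  have "\<forall>u\<in>insert v0 V. \<forall>v\<in>insert v0 V. (\<Sum>i\<in>I. a' u i * A i v) = (if u = v then 1 else 0)"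
    unfolding * using i0 insert.hyps by (auto simp: \<phi>V \<phi>0 a c_def[symmetric])
  then show ?case by blast
qed

text \<open>
  In operator notation the last two summation hypotheses are \<open>M (1 \<otimes> Y) = n \<otimes> 1\<close> and
  \<open>N (1 \<otimes> Y') = n' \<otimes> 1\<close>, and the conclusion is \<open>M = n \<otimes> Y' / l\<close>, \<open>N = n' \<otimes> Y / l\<close>.
\<close>

lemma tensor_factorization:
  fixes M :: "'x \<Rightarrow> 'z \<Rightarrow> 'c \<Rightarrow> 'y \<Rightarrow> 'a::field" and N :: "'c \<Rightarrow> 'y \<Rightarrow> 'x \<Rightarrow> 'z \<Rightarrow> 'a"
  assumes fin: "finite I" "finite J" "finite I'" "finite J'"
    and MN: "\<And>x z x' z'. \<lbrakk>x \<in> I; z \<in> J; x' \<in> I; z' \<in> J\<rbrakk> \<Longrightarrow>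
      (\<Sum>c\<in>I'. \<Sum>y\<in>J'. M x z c y * N c y x' z') = (if x = x' \<and> z = z' then 1 else 0)"
    and NM: "\<And>c y c' y'. \<lbrakk>c \<in> I'; y \<in> J'; c' \<in> I'; y' \<in> J'\<rbrakk> \<Longrightarrow>
      (\<Sum>x\<in>I. \<Sum>z\<in>J. N c y x z * M x z c' y') = (if c = c' \<and> y = y' then 1 else 0)"
    and Y: "\<And>x z c z'. \<lbrakk>x \<in> I; z \<in> J; c \<in> I'; z' \<in> J\<rbrakk> \<Longrightarrow>
      (\<Sum>y\<in>J'. M x z c y * Y y z') = (if z = z' then n x c else 0)"
    and Y': "\<And>x y c y'. \<lbrakk>x \<in> I; y \<in> J'; c \<in> I'; y' \<in> J'\<rbrakk> \<Longrightarrow>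
      (\<Sum>z\<in>J. N c y x z * Y' z y') = (if y = y' then n' c x else 0)"
    and n: "\<exists>x\<in>I. \<exists>c\<in>I'. n x c \<noteq> 0" and n': "\<exists>x\<in>I. \<exists>c\<in>I'. n' c x \<noteq> 0"
    and J: "J \<noteq> {}"
  obtains l where "l \<noteq> 0"
    "\<And>x x'. \<lbrakk>x \<in> I; x' \<in> I\<rbrakk> \<Longrightarrow> (\<Sum>c\<in>I'. n x c * n' c x') = (if x = x' then l else 0)"
    "\<And>c c'. \<lbrakk>c \<in> I'; c' \<in> I'\<rbrakk> \<Longrightarrow> (\<Sum>x\<in>I. n' c x * n x c') = (if c = c' then l else 0)"
    "\<And>x z c y. \<lbrakk>x \<in> I; z \<in> J; c \<in> I'; y \<in> J'\<rbrakk> \<Longrightarrow> M x z c y = n x c * (Y' z y / l)"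
    "\<And>x z c y. \<lbrakk>x \<in> I; z \<in> J; c \<in> I'; y \<in> J'\<rbrakk> \<Longrightarrow> N c y x z = n' c x * (Y y z / l)"
proof -
  \<comment> \<open>Multiplying \<open>N (1 \<otimes> Y') = n' \<otimes> 1\<close> by
    \<open>M\<close> from the left gives \<open>M (n' \<otimes> 1) = 1 \<otimes> Y'\<close>. In the
    same way \<open>Nn\<close> reads \<open>N (n \<otimes> 1) = 1 \<otimes> Y\<close>.\<close>
  have Mn': "(\<Sum>c\<in>I'. M x z c y * n' c x') = (if x = x' then Y' z y else 0)"
    if "x \<in> I" "z \<in> J" "y \<in> J'" "x' \<in> I" for x z y x'
  proof -
    have "(\<Sum>c\<in>I'. M x z c y * n' c x') = (\<Sum>c\<in>I'. \<Sum>y'\<in>J'. M x z c y' * (if y' = y then n' c x' else 0))"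
      using that fin by (simp add: if_distrib sum.delta cong: if_cong)
    also have "\<dots> = (\<Sum>c\<in>I'. \<Sum>y'\<in>J'. M x z c y' * (\<Sum>z'\<in>J. N c y' x' z' * Y' z' y))"
      using that by (intro sum.cong refl) (simp add: Y')
    also have "\<dots> = (\<Sum>c\<in>I'. \<Sum>y'\<in>J'. \<Sum>z'\<in>J. M x z c y' * N c y' x' z' * Y' z' y)"
      by (simp add: sum_distrib_left mult.assoc)
    also have "\<dots> = (\<Sum>c\<in>I'. \<Sum>z'\<in>J. \<Sum>y'\<in>J'. M x z c y' * N c y' x' z' * Y' z' y)"
      by (intro sum.cong refl sum.swap)
    also have "\<dots> = (\<Sum>z'\<in>J. \<Sum>c\<in>I'. \<Sum>y'\<in>J'. M x z c y' * N c y' x' z' * Y' z' y)"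
      by (rule sum.swap)
    also have "\<dots> = (\<Sum>z'\<in>J. (\<Sum>c\<in>I'. \<Sum>y'\<in>J'. M x z c y' * N c y' x' z') * Y' z' y)"
      by (simp add: sum_distrib_right)
    also have "\<dots> = (\<Sum>z'\<in>J. if z = z' then (if x = x' then Y' z' y else 0) else 0)"
      using that by (intro sum.cong refl) (simp add: MN)
    also have "\<dots> = (if x = x' then Y' z y else 0)" using that fin by (simp add: sum.delta)
    finally show ?thesis .
  qed
  have Nn: "(\<Sum>x\<in>I. N c y x z * n x c') = (if c = c' then Y y z else 0)"
    if "c \<in> I'" "z \<in> J" "y \<in> J'" "c' \<in> I'" for c z y c'
  proof -
    have "(\<Sum>x\<in>I. N c y x z * n x c') = (\<Sum>x\<in>I. \<Sum>z'\<in>J. N c y x z' * (if z' = z then n x c' else 0))"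
      using that fin by (simp add: if_distrib sum.delta cong: if_cong)
    also have "\<dots> = (\<Sum>x\<in>I. \<Sum>z'\<in>J. N c y x z' * (\<Sum>y'\<in>J'. M x z' c' y' * Y y' z))"
      using that by (intro sum.cong refl) (simp add: Y)
    also have "\<dots> = (\<Sum>x\<in>I. \<Sum>z'\<in>J. \<Sum>y'\<in>J'. N c y x z' * M x z' c' y' * Y y' z)"
      by (simp add: sum_distrib_left mult.assoc)
    also have "\<dots> = (\<Sum>x\<in>I. \<Sum>y'\<in>J'. \<Sum>z'\<in>J. N c y x z' * M x z' c' y' * Y y' z)"
      by (intro sum.cong refl sum.swap)
    also have "\<dots> = (\<Sum>y'\<in>J'. \<Sum>x\<in>I. \<Sum>z'\<in>J. N c y x z' * M x z' c' y' * Y y' z)"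
      by (rule sum.swap)
    also have "\<dots> = (\<Sum>y'\<in>J'. (\<Sum>x\<in>I. \<Sum>z'\<in>J. N c y x z' * M x z' c' y') * Y y' z)"
      by (simp add: sum_distrib_right)
    also have "\<dots> = (\<Sum>y'\<in>J'. if y = y' then (if c = c' then Y y' z else 0) else 0)"
      using that by (intro sum.cong refl) (simp add: NM)
    also have "\<dots> = (if c = c' then Y y z else 0)" using that fin by (simp add: sum.delta)
    finally show ?thesis .
  qed
  \<comment> \<open>Evaluating \<open>M (n' \<otimes> Y)\<close> in two orders gives
    \<open>n n' \<otimes> 1 = 1 \<otimes> Y' Y\<close>, which forces \<open>n n'\<close> and
    \<open>Y' Y\<close> to be the same scalar.\<close>
  have nn'_Y'Y: "(if z = z' then (\<Sum>c\<in>I'. n x c * n' c x') else 0)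
      = (if x = x' then (\<Sum>y\<in>J'. Y' z y * Y y z') else 0)"
    if "x \<in> I" "x' \<in> I" "z \<in> J" "z' \<in> J" for x x' z z'
  proof -
    have "(if z = z' then (\<Sum>c\<in>I'. n x c * n' c x') else 0)
        = (\<Sum>c\<in>I'. (\<Sum>y\<in>J'. M x z c y * Y y z') * n' c x')"
      using that by (simp add: Y)
    also have "\<dots> = (\<Sum>c\<in>I'. \<Sum>y\<in>J'. M x z c y * n' c x' * Y y z')"
      by (simp add: sum_distrib_left sum_distrib_right mult_ac)
    also have "\<dots> = (\<Sum>y\<in>J'. \<Sum>c\<in>I'. M x z c y * n' c x' * Y y z')"
      by (rule sum.swap)
    also have "\<dots> = (\<Sum>y\<in>J'. (\<Sum>c\<in>I'. M x z c y * n' c x') * Y y z')"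
      by (simp add: sum_distrib_right)
    also have "\<dots> = (\<Sum>y\<in>J'. (if x = x' then Y' z y else 0) * Y y z')"
      using that by (intro sum.cong refl) (simp add: Mn')
    finally show ?thesis by simp
  qed
  have n'n_YY': "(if y = y' then (\<Sum>x\<in>I. n' c x * n x c') else 0)
      = (if c = c' then (\<Sum>z\<in>J. Y y z * Y' z y') else 0)"
    if "c \<in> I'" "c' \<in> I'" "y \<in> J'" "y' \<in> J'" for c c' y y'
  proof -
    have "(if y = y' then (\<Sum>x\<in>I. n' c x * n x c') else 0)
        = (\<Sum>x\<in>I. (\<Sum>z\<in>J. N c y x z * Y' z y') * n x c')"
      using that by (simp add: Y')
    also have "\<dots> = (\<Sum>x\<in>I. \<Sum>z\<in>J. N c y x z * n x c' * Y' z y')"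
      by (simp add: sum_distrib_left sum_distrib_right mult_ac)
    also have "\<dots> = (\<Sum>z\<in>J. \<Sum>x\<in>I. N c y x z * n x c' * Y' z y')"
      by (rule sum.swap)
    also have "\<dots> = (\<Sum>z\<in>J. (\<Sum>x\<in>I. N c y x z * n x c') * Y' z y')"
      by (simp add: sum_distrib_right)
    also have "\<dots> = (\<Sum>z\<in>J. (if c = c' then Y y z else 0) * Y' z y')"
      using that by (intro sum.cong refl) (simp add: Nn)
    finally show ?thesis by simp
  qed
  obtain x0 c0 where xc0: "x0 \<in> I" "c0 \<in> I'" "n x0 c0 \<noteq> 0" using n by blast
  obtain x1 c1 where xc1: "x1 \<in> I" "c1 \<in> I'" "n' c1 x1 \<noteq> 0" using n' by blast
  obtain z0 where z0: "z0 \<in> J" using J by blast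
  \<comment> \<open>An empty \<open>J'\<close> would turn \<open>n x0 c0\<close> into an empty
    sum.\<close>
  have J': "\<exists>y. y \<in> J'"
    using Y[OF xc0(1) z0 xc0(2) z0] xc0(3) by (metis (full_types) sum.neutral)
  then obtain y0 where y0: "y0 \<in> J'" by blast
  define l where "l = (\<Sum>y\<in>J'. Y' z0 y * Y y z0)"
  define m where "m = (\<Sum>z\<in>J. Y y0 z * Y' z y0)"
  have nn': "(\<Sum>c\<in>I'. n x c * n' c x') = (if x = x' then l else 0)" if "x \<in> I" "x' \<in> I" for x x'
    using nn'_Y'Y[OF that z0 z0] by (simp add: l_def)
  have n'n: "(\<Sum>x\<in>I. n' c x * n x c') = (if c = c' then m else 0)" if "c \<in> I'" "c' \<in> I'" for c c'
    using n'n_YY'[OF that y0 y0] by (simp add: m_def)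
  \<comment> \<open>The scalars of \<open>n n'\<close> and \<open>n' n\<close> agree by
    associativity: \<open>l n = (n n') n = n (n' n) = m n\<close>, read at a nonzero entry of
    \<open>n\<close>.\<close>
  have "l * n x0 c0 = (\<Sum>x\<in>I. (\<Sum>c\<in>I'. n x0 c * n' c x) * n x c0)"
  proof -
    have "(\<Sum>x\<in>I. (\<Sum>c\<in>I'. n x0 c * n' c x) * n x c0) = (\<Sum>x\<in>I. if x0 = x then l * n x c0 else 0)"
      using xc0 by (intro sum.cong refl) (simp add: nn')
    then show ?thesis using xc0 fin by simp
  qed
  also have "\<dots> = (\<Sum>x\<in>I. \<Sum>c\<in>I'. n x0 c * (n' c x * n x c0))"
    by (simp add: sum_distrib_right mult.assoc)
  also have "\<dots> = (\<Sum>c\<in>I'. n x0 c * (\<Sum>x\<in>I. n' c x * n x c0))"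
    by (subst sum.swap) (simp add: sum_distrib_left)
  also have "\<dots> = (\<Sum>c\<in>I'. if c = c0 then m * n x0 c else 0)"
    using xc0 by (intro sum.cong refl) (simp add: n'n)
  also have "\<dots> = m * n x0 c0" using xc0 fin by simp
  finally have lm: "l = m" using xc0 by simp
  \<comment> \<open>For \<open>l = 0\<close> the column \<open>z0\<close> of \<open>Y' Y\<close>
    vanishes. Applying \<open>N\<close> and \<open>N (1 \<otimes> Y') = n' \<otimes> 1\<close>
    leaves a nonzero entry of \<open>n'\<close> times the column \<open>z0\<close> of
    \<open>Y\<close>, so that column is zero, and with it \<open>n x0 c0\<close>.\<close>
  have l0: "l \<noteq> 0"
  proof
    assume l: "l = 0"
    have Y'Y0: "(\<Sum>y\<in>J'. Y' z y * Y y z0) = 0" if "z \<in> J" for z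
    proof (cases "z = z0")
      case True
      then show ?thesis using l by (simp add: l_def)
    next
      case False
      then show ?thesis using nn'_Y'Y[OF xc0(1,1) that z0] by simp
    qed
    have Y0: "Y y z0 = 0" if y: "y \<in> J'" for y
    proof -
      have "0 = (\<Sum>z\<in>J. N c1 y x1 z * (\<Sum>y'\<in>J'. Y' z y' * Y y' z0))"
        by (simp add: Y'Y0)
      also have "\<dots> = (\<Sum>z\<in>J. \<Sum>y'\<in>J'. N c1 y x1 z * Y' z y' * Y y' z0)"
        by (simp add: sum_distrib_left mult.assoc)
      also have "\<dots> = (\<Sum>y'\<in>J'. (\<Sum>z\<in>J. N c1 y x1 z * Y' z y') * Y y' z0)"
        by (subst sum.swap) (simp add: sum_distrib_right)
      also have "\<dots> = (\<Sum>y'\<in>J'. if y = y' then n' c1 x1 * Y y' z0 else 0)"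
        using xc1 y by (intro sum.cong refl) (simp add: Y')
      also have "\<dots> = n' c1 x1 * Y y z0" using y fin by simp
      finally show ?thesis using xc1 by simp
    qed
    have "n x0 c0 = 0"
      using Y[OF xc0(1) z0 xc0(2) z0] by (simp add: Y0)
    then show False using xc0 by simp
  qed
  have "M x z c y = n x c * (Y' z y / l)" if "x \<in> I" "z \<in> J" "c \<in> I'" "y \<in> J'" for x z c y
  proof -
    \<comment> \<open>In operator form: \<open>(1 \<otimes> Y') (n \<otimes> 1) = M (n' n \<otimes>
      1) = l M\<close>.\<close>
    have "n x c * Y' z y = (\<Sum>x'\<in>I. if x = x' then Y' z y * n x' c else 0)"
      using that fin by simp
    also have "\<dots> = (\<Sum>x'\<in>I. (\<Sum>c'\<in>I'. M x z c' y * n' c' x') * n x' c)"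
      using that by (intro sum.cong refl) (simp add: Mn')
    also have "\<dots> = (\<Sum>x'\<in>I. \<Sum>c'\<in>I'. M x z c' y * (n' c' x' * n x' c))"
      by (simp add: sum_distrib_right mult.assoc)
    also have "\<dots> = (\<Sum>c'\<in>I'. M x z c' y * (\<Sum>x'\<in>I. n' c' x' * n x' c))"
      by (subst sum.swap) (simp add: sum_distrib_left)
    also have "\<dots> = (\<Sum>c'\<in>I'. if c' = c then M x z c' y * l else 0)"
      using that by (intro sum.cong refl) (simp add: n'n lm)
    also have "\<dots> = M x z c y * l" using that fin by simp
    finally show ?thesis using l0 by (simp add: field_simps)
  qed
  moreover have "N c y x z = n' c x * (Y y z / l)" if "x \<in> I" "z \<in> J" "c \<in> I'" "y \<in> J'" for x z c y
  proof -
    have "n' c x * Y y z = (\<Sum>c'\<in>I'. if c = c' then Y y z * n' c' x else 0)"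
      using that fin by simp
    also have "\<dots> = (\<Sum>c'\<in>I'. (\<Sum>x'\<in>I. N c y x' z * n x' c') * n' c' x)"
      using that by (intro sum.cong refl) (simp add: Nn)
    also have "\<dots> = (\<Sum>c'\<in>I'. \<Sum>x'\<in>I. N c y x' z * (n x' c' * n' c' x))"
      by (simp add: sum_distrib_right mult.assoc)
    also have "\<dots> = (\<Sum>x'\<in>I. N c y x' z * (\<Sum>c'\<in>I'. n x' c' * n' c' x))"
      by (subst sum.swap) (simp add: sum_distrib_left)
    also have "\<dots> = (\<Sum>x'\<in>I. if x' = x then N c y x' z * l else 0)"
      using that by (intro sum.cong refl) (simp add: nn')
    also have "\<dots> = N c y x z * l" using that fin by simp
    finally show ?thesis using l0 by (simp add: field_simps)
  qed
  ultimately show thesis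
    using that[OF l0 nn'] n'n lm by blast
qed

section \<open>Families of virtual indices\<close>

lemma sum_PiE_split:
  assumes "e \<in> S"
  shows "(\<Sum>w\<in>Pi\<^sub>E S F. g w) = (\<Sum>x\<in>F e. \<Sum>y\<in>Pi\<^sub>E (S - {e}) F. g (y(e := x)))"
proof -
  have S: "S = insert e (S - {e})" using assms by auto
  have "Pi\<^sub>E S F = (\<lambda>(y, g). g(e := y)) ` (F e \<times> Pi\<^sub>E (S - {e}) F)"
    by (subst S) (rule PiE_insert_eq)
  moreover have "inj_on (\<lambda>(y, g). g(e := y)) (F e \<times> Pi\<^sub>E (S - {e}) F)"
    using inj_combinator[of e "S - {e}" F] by simp
  ultimately show ?thesis
    by (simp add: sum.reindex sum.cartesian_product case_prod_unfold)
qed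

lemma finite_index: "finite S \<Longrightarrow> finite (\<Pi>\<^sub>E e\<in>S. {..<(D e::nat)})"
  by (rule finite_PiE) auto

lemma index_nonempty: "(\<And>e. e \<in> S \<Longrightarrow> 0 < D e) \<Longrightarrow> (\<Pi>\<^sub>E e\<in>S. {..<(D e::nat)}) \<noteq> {}"
  by (auto simp: PiE_eq_empty_iff)

lemma restrict_fun_upd_in: "e \<in> S \<Longrightarrow> restrict (w(e := c)) S = (restrict w (S - {e}))(e := c)"
  by (auto simp: fun_eq_iff restrict_def)

subsection \<open>Transfer matrices\<close>

abbreviation bond_indices :: "('e \<Rightarrow> nat) \<Rightarrow> 'e set \<Rightarrow> ('e \<Rightarrow> nat) set" where
  "bond_indices D S \<equiv> (\<Pi>\<^sub>E e\<in>S. {..<D e})"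

text \<open>\<open>no_double\<close> compares unordered pairs of ends, so it also excludes two arcs
  that join the same vertices in opposite directions.\<close>

locale simple_graph = fin_digraph G + loopfree_digraph G for G :: "('v, 'e) pre_digraph" +
  assumes no_double: "inj_on (\<lambda>e. {tail G e, head G e}) (arcs G)"
begin

lemma incident_subset: "incident G s \<subseteq> arcs G"
  by (auto simp: incident_def)

lemma finite_incident [simp]: "finite (incident G s)"
  using incident_subset by (rule finite_subset) simp

lemma in_incident_vert: "e \<in> incident G s \<Longrightarrow> s \<in> verts G"
  by (auto simp: incident_def)

text \<open>This is where the absence of double edges enters. It serves to find an end of each other
  edge away from \<open>s\<close> and \<open>t\<close>, and to separate the remaining edges at
  \<open>s\<close> from those at \<open>t\<close>.\<close>

lemma incident_both_eq:
  assumes "s \<noteq> t" "e \<in> incident G s" "e \<in> incident G t" "f \<in> incident G s" "f \<in> incident G t"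
  shows "f = e"
proof -
  have "e \<in> arcs G" "f \<in> arcs G" "{tail G e, head G e} = {s, t}" "{tail G f, head G f} = {s, t}"
    using assms by (auto simp: incident_def)
  then show ?thesis using no_double by (metis (mono_tags, lifting) inj_onD)
qed

text \<open>Needed when left inverses are applied everywhere except at \<open>s\<close>: every bond
  is still pinned at one of its ends.\<close>

lemma other_endpoint:
  assumes "e \<in> arcs G"
  obtains t where "t \<in> verts G" "t \<noteq> s" "e \<in> incident G t"
proof (cases "tail G e = s")
  case True
  then show thesis using that[of "head G e"] assms no_loops[OF assms] by (auto simp: incident_def)
next
  case False
  then show thesis using that[of "tail G e"] assms by (auto simp: incident_def)
qed

text \<open>The analogue for leaving out both ends of \<open>e\<close>: every other bond is still
  pinned by some third vertex.\<close>

lemma third_endpoint: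
  assumes "f \<in> arcs G" "f \<noteq> e" "s \<noteq> t" "e \<in> incident G s" "e \<in> incident G t"
  obtains r where "r \<in> verts G" "r \<noteq> s" "r \<noteq> t" "f \<in> incident G r"
proof -
  have "f \<in> incident G (tail G f)" "f \<in> incident G (head G f)"
    using assms by (auto simp: incident_def)
  moreover have "\<not> (f \<in> incident G s \<and> f \<in> incident G t)"
    using incident_both_eq assms by blast
  moreover have "tail G f \<noteq> head G f" using no_loops assms by blast
  ultimately show ?thesis using that in_incident_vert by metis
qed

lemma vertex_not_incident:
  assumes "e \<in> incident G s" "e \<in> incident G t" "s \<noteq> t" "r \<noteq> s" "r \<noteq> t"
  shows "e \<notin> incident G r"
  using assms by (auto simp: incident_def)

lemma restrict_bond_indices:
  "\<lbrakk>w \<in> bond_indices D S; T \<subseteq> S\<rbrakk> \<Longrightarrow> restrict w T \<in> bond_indices D T"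
  by auto

lemma extend_bond_index:
  assumes "v \<in> bond_indices D (incident G s)" "\<And>e. e \<in> arcs G \<Longrightarrow> 0 < D e"
  obtains w where "w \<in> bond_indices D (arcs G)" "restrict w (incident G s) = v"
proof
  let ?w = "\<lambda>e\<in>arcs G. if e \<in> incident G s then v e else 0"
  show "?w \<in> bond_indices D (arcs G)" using assms by auto
  show "restrict ?w (incident G s) = v"
    using assms incident_subset[of s] by (auto simp: fun_eq_iff restrict_def PiE_def extensional_def)
qed

text \<open>Pairing a state with a product of functionals, one per vertex, amounts to applying each
  functional to its own tensor before contracting the bonds, since a product of sums over physical
  indices is a sum over joint physical indices.\<close>

lemma contract_functionals:
  fixes A :: "'v \<Rightarrow> 'e tensor"
  shows "(\<Sum>p\<in>Pi\<^sub>E (verts G) (\<lambda>s. {..<d s}). (\<Prod>s\<in>verts G. f s (p s)) *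
        (\<Sum>w\<in>bond_indices D (arcs G). \<Prod>s\<in>verts G. A s (p s) (restrict w (incident G s))))
      = (\<Sum>w\<in>bond_indices D (arcs G). \<Prod>s\<in>verts G. \<Sum>i<d s. f s i * A s i (restrict w (incident G s)))"
proof -
  have "(\<Sum>w\<in>bond_indices D (arcs G). \<Prod>s\<in>verts G. \<Sum>i<d s. f s i * A s i (restrict w (incident G s)))
     = (\<Sum>w\<in>bond_indices D (arcs G). \<Sum>p\<in>Pi\<^sub>E (verts G) (\<lambda>s. {..<d s}).
          \<Prod>s\<in>verts G. f s (p s) * A s (p s) (restrict w (incident G s)))"
    by (intro sum.cong refl prod_sum_PiE) auto
  also have "\<dots> = (\<Sum>p\<in>Pi\<^sub>E (verts G) (\<lambda>s. {..<d s}). \<Sum>w\<in>bond_indices D (arcs G).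
          \<Prod>s\<in>verts G. f s (p s) * A s (p s) (restrict w (incident G s)))"
    by (rule sum.swap)
  finally show ?thesis by (simp add: prod.distrib sum_distrib_left)
qed

end

text \<open>The matrix of the composite of \<open>B s\<close> with the functionals
  \<open>a s\<close>, acting between virtual spaces. With \<open>B\<close> replaced by
  \<open>A\<close>, the statement that \<open>a\<close> is a left inverse says that this matrix is
  the identity.\<close>

definition transfer ::
  "('v \<Rightarrow> nat) \<Rightarrow> ('v \<Rightarrow> ('e \<Rightarrow> nat) \<Rightarrow> nat \<Rightarrow> complex) \<Rightarrow> ('v \<Rightarrow> 'e tensor) \<Rightarrow>
    'v \<Rightarrow> ('e \<Rightarrow> nat) \<Rightarrow> ('e \<Rightarrow> nat) \<Rightarrow> complex" where
  "transfer d a B s u w = (\<Sum>i<d s. a s u i * B s i w)"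

section \<open>Two PEPS with the same state and chosen left inverses\<close>

locale equal_state_peps = simple_graph G for G :: "('v, 'e) pre_digraph" +
  fixes d :: "'v \<Rightarrow> nat" and D D' :: "'e \<Rightarrow> nat" and A B :: "'v \<Rightarrow> 'e tensor"
    and a b :: "'v \<Rightarrow> ('e \<Rightarrow> nat) \<Rightarrow> nat \<Rightarrow> complex"
  assumes D_pos: "e \<in> arcs G \<Longrightarrow> 0 < D e" and D'_pos: "e \<in> arcs G \<Longrightarrow> 0 < D' e"
    and dual_A: "\<lbrakk>s \<in> verts G; u \<in> bond_indices D (incident G s); v \<in> bond_indices D (incident G s)\<rbrakk>
      \<Longrightarrow> transfer d a A s u v = (if u = v then 1 else 0)"
    and dual_B: "\<lbrakk>s \<in> verts G; u \<in> bond_indices D' (incident G s); v \<in> bond_indices D' (incident G s)\<rbrakk>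
      \<Longrightarrow> transfer d b B s u v = (if u = v then 1 else 0)"
    and same_state: "peps_state G d D A = peps_state G d D' B"
begin

abbreviation M where "M \<equiv> transfer d a B"
abbreviation N where "N \<equiv> transfer d b A"

text \<open>The hypotheses are symmetric in the two PEPS, so each result proved for
  \<open>A\<close>, \<open>M\<close> transfers to \<open>B\<close>, \<open>N\<close> and
  conversely.\<close>

lemma swapped: "equal_state_peps G d D' D B A b a"
  by unfold_locales (auto simp: D_pos D'_pos dual_A dual_B same_state)

text \<open>The form in which equality of the states is used: any choice of functionals at the
  vertices yields the same number from both networks.\<close>

lemma contract_eq:
  "(\<Sum>w\<in>bond_indices D (arcs G). \<Prod>s\<in>verts G. \<Sum>i<d s. f s i * A s i (restrict w (incident G s)))
   = (\<Sum>w\<in>bond_indices D' (arcs G). \<Prod>s\<in>verts G. \<Sum>i<d s. f s i * B s i (restrict w (incident G s)))"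
proof -
  have "(\<Sum>w\<in>bond_indices D (arcs G). \<Prod>s\<in>verts G. A s (p s) (restrict w (incident G s)))
     = (\<Sum>w\<in>bond_indices D' (arcs G). \<Prod>s\<in>verts G. B s (p s) (restrict w (incident G s)))"
    if "p \<in> Pi\<^sub>E (verts G) (\<lambda>s. {..<d s})" for p
    using fun_cong[OF same_state, of p] that unfolding peps_state_def by simp
  then show ?thesis
    unfolding contract_functionals[symmetric] by simp
qed

text \<open>Left inverses of \<open>A\<close> at all vertices but \<open>s\<close> reduce the first
  network to the single column \<open>A s i v\<close>. The second network under the same functionals
  is \<open>B s\<close> contracted with the rest, and that rest is the vector
  \<open>R\<close>.\<close>

lemma A_in_range_B:
  assumes s: "s \<in> verts G" and v: "v \<in> bond_indices D (incident G s)"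
  obtains R where "\<And>i. i < d s \<Longrightarrow> A s i v = (\<Sum>w\<in>bond_indices D' (incident G s). B s i w * R w)"
proof -
  obtain u where u: "u \<in> bond_indices D (arcs G)" "restrict u (incident G s) = v"
    using extend_bond_index[OF v] D_pos by blast
  \<comment> \<open>\<open>Q\<close> is the rest of the second network at fixed bond values, and
    \<open>R\<close> sums it over the bonds away from \<open>s\<close>. Both are fixed before the
    physical index \<open>i\<close>, so one \<open>R\<close> serves all \<open>i\<close>.\<close>
  define Q where "Q w = (\<Prod>r\<in>verts G - {s}. M r (restrict u (incident G r)) (restrict w (incident G r)))" for w
  define R where "R y = (\<Sum>w\<in>{w \<in> bond_indices D' (arcs G). restrict w (incident G s) = y}. Q w)" for y
  have "A s i v = (\<Sum>w\<in>bond_indices D' (incident G s). B s i w * R w)" if i: "i < d s" for i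
  proof -
    \<comment> \<open>At \<open>s\<close> the functional only reads off the physical coordinate
      \<open>i\<close>.\<close>
    define f where "f r j = (if r = s then (if j = i then 1 else 0) else a r (restrict u (incident G r)) j)" for r j
    have fs: "(\<Sum>j<d s. f s j * X j) = X i" for X
      using i by (simp add: f_def if_distrib[of "\<lambda>x. x * _"] cong: if_cong)
    have split: "(\<Prod>r\<in>verts G. \<Sum>j<d r. f r j * X r j)
       = X s i * (\<Prod>r\<in>verts G - {s}. \<Sum>j<d r. a r (restrict u (incident G r)) j * X r j)" for X
    proof -
      have "(\<Prod>r\<in>verts G - {s}. \<Sum>j<d r. f r j * X r j)
        = (\<Prod>r\<in>verts G - {s}. \<Sum>j<d r. a r (restrict u (incident G r)) j * X r j)"
        by (intro prod.cong refl) (simp add: f_def)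
      then show ?thesis using s by (simp add: prod.remove[of _ s] fs)
    qed
    have "(\<Sum>w\<in>bond_indices D (arcs G). \<Prod>r\<in>verts G. \<Sum>j<d r. f r j * A r j (restrict w (incident G r)))
       = (\<Sum>w\<in>bond_indices D (arcs G). if w = u then A s i v else 0)"
    proof (intro sum.cong refl)
      fix w assume w: "w \<in> bond_indices D (arcs G)"
      have "(\<Prod>r\<in>verts G - {s}. \<Sum>j<d r. a r (restrict u (incident G r)) j * A r j (restrict w (incident G r)))
        = (\<Prod>r\<in>verts G - {s}. if restrict u (incident G r) = restrict w (incident G r) then 1 else 0)"
      proof (intro prod.cong refl)
        fix r assume "r \<in> verts G - {s}"
        then show "(\<Sum>j<d r. a r (restrict u (incident G r)) j * A r j (restrict w (incident G r)))
          = (if restrict u (incident G r) = restrict w (incident G r) then 1 else 0)"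
          using dual_A[OF _ restrict_bond_indices[OF u(1) incident_subset]
              restrict_bond_indices[OF w incident_subset]]
          by (simp add: transfer_def)
      qed
      also have "\<dots> = (if w = u then 1 else 0)"
      proof (cases "w = u")
        case False
        then obtain e where e: "e \<in> arcs G" "w e \<noteq> u e"
          using u w by (meson PiE_ext)
        obtain t where t: "t \<in> verts G" "t \<noteq> s" "e \<in> incident G t"
          using other_endpoint[OF e(1)] by blast
        \<comment> \<open>The edge where \<open>w\<close> and \<open>u\<close> differ has an end
          \<open>t\<close> other than \<open>s\<close>, and the factor at \<open>t\<close>
          vanishes.\<close>
        have "restrict u (incident G t) \<noteq> restrict w (incident G t)"
          using e t by (metis restrict_apply')
        then have "(\<Prod>r\<in>verts G - {s}. if restrict u (incident G r) = restrict w (incident G r) then 1 else 0 :: complex) = 0"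
          using t by (intro prod_zero) auto
        then show ?thesis using False by simp
      qed simp
      finally show "(\<Prod>r\<in>verts G. \<Sum>j<d r. f r j * A r j (restrict w (incident G r))) = (if w = u then A s i v else 0)"
        using u by (simp add: split)
    qed
    also have "\<dots> = A s i v" using u by (simp add: finite_index)
    finally have "A s i v = (\<Sum>w\<in>bond_indices D' (arcs G). B s i (restrict w (incident G s)) * Q w)"
      unfolding contract_eq by (simp add: split Q_def transfer_def)
    also have "\<dots> = (\<Sum>y\<in>bond_indices D' (incident G s). \<Sum>w\<in>{w \<in> bond_indices D' (arcs G). restrict w (incident G s) = y}.
         B s i (restrict w (incident G s)) * Q w)"
      using restrict_bond_indices[OF _ incident_subset, of _ D']
      by (intro sum.group[symmetric] image_subsetI) (simp_all add: finite_index)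
    also have "\<dots> = (\<Sum>y\<in>bond_indices D' (incident G s). B s i y * R y)"
      by (simp add: R_def sum_distrib_left)
    finally show ?thesis .
  qed
  then show ?thesis using that by blast
qed

text \<open>Applying \<open>b s\<close> to the expansion of \<open>A s\<close> in the columns of
  \<open>B s\<close> identifies its coefficients as the entries of \<open>N s\<close>.\<close>

lemma recover_A:
  assumes s: "s \<in> verts G" and v: "v \<in> bond_indices D (incident G s)" and i: "i < d s"
  shows "A s i v = (\<Sum>w\<in>bond_indices D' (incident G s). B s i w * N s w v)"
proof -
  obtain R where R: "\<And>i. i < d s \<Longrightarrow> A s i v = (\<Sum>w\<in>bond_indices D' (incident G s). B s i w * R w)"
    using A_in_range_B[OF s v] by blast
  have "N s w v = R w" if w: "w \<in> bond_indices D' (incident G s)" for w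
  proof -
    have "N s w v = (\<Sum>i<d s. \<Sum>y\<in>bond_indices D' (incident G s). b s w i * B s i y * R y)"
      by (simp add: transfer_def R sum_distrib_left mult.assoc)
    also have "\<dots> = (\<Sum>y\<in>bond_indices D' (incident G s). transfer d b B s w y * R y)"
      by (subst sum.swap) (simp add: transfer_def sum_distrib_right)
    also have "\<dots> = (\<Sum>y\<in>bond_indices D' (incident G s). if w = y then R y else 0)"
      using s w by (intro sum.cong refl) (simp add: dual_B)
    also have "\<dots> = R w" using w by (simp add: finite_index)
    finally show ?thesis .
  qed
  then show ?thesis using R[OF i] by simp
qed

lemma recover_B:
  assumes s: "s \<in> verts G" and w: "w \<in> bond_indices D' (incident G s)" and i: "i < d s"
  shows "B s i w = (\<Sum>v\<in>bond_indices D (incident G s). A s i v * M s v w)"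
  using equal_state_peps.recover_A[OF swapped assms] .

text \<open>Since \<open>A s = B s N s\<close>, the product \<open>M s N s\<close> is
  \<open>a s B s N s = a s A s\<close>, the identity.\<close>

lemma M_N:
  assumes s: "s \<in> verts G" and u: "u \<in> bond_indices D (incident G s)" and v: "v \<in> bond_indices D (incident G s)"
  shows "(\<Sum>w\<in>bond_indices D' (incident G s). M s u w * N s w v) = (if u = v then 1 else 0)"
proof -
  have "(\<Sum>w\<in>bond_indices D' (incident G s). M s u w * N s w v)
     = (\<Sum>w\<in>bond_indices D' (incident G s). \<Sum>i<d s. a s u i * (B s i w * N s w v))"
    unfolding transfer_def[of d a] by (simp add: sum_distrib_right mult.assoc)
  also have "\<dots> = (\<Sum>i<d s. a s u i * (\<Sum>w\<in>bond_indices D' (incident G s). B s i w * N s w v))"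
    by (subst sum.swap) (simp add: sum_distrib_left)
  also have "\<dots> = transfer d a A s u v"
    using recover_A[OF s v] by (simp add: transfer_def)
  finally show ?thesis using dual_A[OF s u v] by simp
qed

lemma N_M:
  assumes "s \<in> verts G" "u \<in> bond_indices D' (incident G s)" "v \<in> bond_indices D' (incident G s)"
  shows "(\<Sum>w\<in>bond_indices D (incident G s). N s u w * M s w v) = (if u = v then 1 else 0)"
  using equal_state_peps.M_N[OF swapped assms] .

end

subsection \<open>Factorization at one edge\<close>

text \<open>Splitting off the index at \<open>e\<close> is unambiguous because the remaining family
  takes the default value \<open>undefined\<close> at \<open>e\<close>.\<close>

lemma fun_upd_eq_iff_PiE:
  assumes "z \<in> Pi\<^sub>E (S - {e}) F" "y \<in> Pi\<^sub>E (S - {e}) F'"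
  shows "z(e := x) = y(e := x') \<longleftrightarrow> z = y \<and> x = x'"
proof
  assume *: "z(e := x) = y(e := x')"
  have "z f = y f" for f
  proof (cases "f = e")
    case True
    then show ?thesis using PiE_arb[OF assms(1), of f] PiE_arb[OF assms(2), of f] by simp
  next
    case False
    then show ?thesis using fun_cong[OF *, of f] by simp
  qed
  then have "z = y" by (rule ext)
  moreover have "x = x'" using fun_cong[OF *, of e] by simp
  ultimately show "z = y \<and> x = x'" ..
qed simp

lemma fun_upd_bond_indices:
  assumes "z \<in> bond_indices D (S - {e})" "e \<in> S" "x < D e"
  shows "z(e := x) \<in> bond_indices D S"
proof -
  have "z(e := x) \<in> bond_indices D (insert e (S - {e}))"
    using assms by (intro PiE_fun_upd) auto
  then show ?thesis using assms(2) by (simp only: insert_Diff)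
qed

context equal_state_peps
begin

text \<open>Both networks are tested with \<open>a\<close> at every vertex except \<open>t\<close>,
  where \<open>b\<close> is used. In the first network \<open>a\<close> pins all bonds and leaves an
  entry of \<open>N t\<close>. In the second, \<open>b\<close> pins only the bonds at
  \<open>t\<close> and leaves transfer matrices \<open>M\<close> at all other vertices.\<close>

lemma edge_identity:
  assumes st: "s \<noteq> t" and es: "e \<in> incident G s" and et: "e \<in> incident G t"
    and z: "z \<in> bond_indices D (incident G s - {e})" and x: "x < D e"
    and y0: "y0 \<in> bond_indices D' (incident G t - {e})" and c: "c < D' e"
    and U: "U \<in> bond_indices D (arcs G - {e})"
  shows "(if z = restrict U (incident G s - {e})
      then N t (y0(e := c)) ((restrict U (incident G t - {e}))(e := x)) else 0)
    = (\<Sum>w\<in>bond_indices D' (arcs G - {e}). M s (z(e := x)) ((restrict w (incident G s - {e}))(e := c)) *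
        (if restrict w (incident G t - {e}) = y0
         then \<Prod>r\<in>verts G - {s, t}. M r (restrict U (incident G r)) (restrict w (incident G r)) else 0))"
    (is "?L = ?R")
proof -
  define os where "os = incident G s - {e}"
  define ot where "ot = incident G t - {e}"
  have e: "e \<in> arcs G" using es incident_subset by auto
  have s: "s \<in> verts G" and t: "t \<in> verts G" using es et in_incident_vert by auto
  have os: "os \<subseteq> arcs G - {e}" and ot: "ot \<subseteq> arcs G - {e}"
    using incident_subset by (auto simp: os_def ot_def)
  have er: "e \<notin> incident G r" if "r \<in> verts G - {s, t}" for r
    using that vertex_not_incident[OF es et st] by auto
  have Ur: "restrict U (incident G r) \<in> bond_indices D (incident G r)" if "r \<in> verts G - {s, t}" for r
    using er[OF that] incident_subset[of r] by (intro restrict_bond_indices[OF U]) auto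
  have zx: "z(e := x) \<in> bond_indices D (incident G s)"
    using z es x by (rule fun_upd_bond_indices)
  have yc: "y0(e := c) \<in> bond_indices D' (incident G t)"
    using y0 et c by (rule fun_upd_bond_indices)
  \<comment> \<open>\<open>U\<close> prescribes the bonds off \<open>e\<close> at the vertices other
    than \<open>s\<close> and \<open>t\<close>, while \<open>z\<close> is a separate prescription at
    \<open>s\<close>; the two must agree for a nonzero result.\<close>
  define f where "f r = (if r = s then a s (z(e := x)) else if r = t then b t (y0(e := c))
    else a r (restrict U (incident G r)))" for r
  have split: "(\<Prod>r\<in>verts G. \<Sum>j<d r. f r j * X r j)
     = (\<Sum>j<d s. a s (z(e := x)) j * X s j) * (\<Sum>j<d t. b t (y0(e := c)) j * X t j) *
       (\<Prod>r\<in>verts G - {s, t}. \<Sum>j<d r. a r (restrict U (incident G r)) j * X r j)" for X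
  proof -
    have "(\<Prod>r\<in>verts G - {s, t}. \<Sum>j<d r. f r j * X r j)
      = (\<Prod>r\<in>verts G - {s, t}. \<Sum>j<d r. a r (restrict U (incident G r)) j * X r j)"
      by (intro prod.cong refl) (auto simp: f_def)
    moreover have "verts G - {s} - {t} = verts G - {s, t}" by auto
    ultimately show ?thesis using s t st
      by (simp add: prod.remove[of "verts G" s] prod.remove[of "verts G - {s}" t] f_def mult.assoc)
  qed
  define P where "P = ?L"
  have "(\<Sum>w\<in>bond_indices D (arcs G). \<Prod>r\<in>verts G. \<Sum>j<d r. f r j * A r j (restrict w (incident G r)))
     = (\<Sum>x'<D e. \<Sum>w\<in>bond_indices D (arcs G - {e}).
          \<Prod>r\<in>verts G. \<Sum>j<d r. f r j * A r j (restrict (w(e := x')) (incident G r)))"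
    using sum_PiE_split[OF e] .
  also have "\<dots> = (\<Sum>x'<D e. \<Sum>w\<in>bond_indices D (arcs G - {e}). if w = U then (if x = x' then P else 0) else 0)"
  proof (intro sum.cong refl)
    fix x' w assume x': "x' \<in> {..<D e}" and w: "w \<in> bond_indices D (arcs G - {e})"
    have wos: "restrict w os \<in> bond_indices D os" using w os by (rule restrict_bond_indices)
    have m: "(restrict w os)(e := x') \<in> bond_indices D (incident G s)"
      by (rule fun_upd_bond_indices[OF wos[unfolded os_def] es, folded os_def]) (use x' in simp)
    have "(\<Sum>j<d s. a s (z(e := x)) j * A s j (restrict (w(e := x')) (incident G s))) = transfer d a A s (z(e := x)) ((restrict w os)(e := x'))"
      unfolding restrict_fun_upd_in[OF es] os_def[symmetric] transfer_def ..
    also have "\<dots> = (if z(e := x) = (restrict w os)(e := x') then 1 else 0)"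
      by (rule dual_A[OF s zx m])
    also have "z(e := x) = (restrict w os)(e := x') \<longleftrightarrow> z = restrict w os \<and> x = x'"
      using fun_upd_eq_iff_PiE[OF z wos[unfolded os_def]] unfolding os_def .
    finally have 1: "(\<Sum>j<d s. a s (z(e := x)) j * A s j (restrict (w(e := x')) (incident G s)))
      = (if z = restrict w os \<and> x = x' then 1 else 0)" .
    have 2: "(\<Sum>j<d t. b t (y0(e := c)) j * A t j (restrict (w(e := x')) (incident G t)))
      = N t (y0(e := c)) ((restrict w ot)(e := x'))"
      unfolding restrict_fun_upd_in[OF et] ot_def[symmetric] transfer_def ..
    have "(\<Prod>r\<in>verts G - {s, t}. \<Sum>j<d r. a r (restrict U (incident G r)) j * A r j (restrict (w(e := x')) (incident G r)))
       = (\<Prod>r\<in>verts G - {s, t}. if restrict U (incident G r) = restrict w (incident G r) then 1 else 0)"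
    proof (intro prod.cong refl)
      fix r assume r: "r \<in> verts G - {s, t}"
      have "restrict w (incident G r) \<in> bond_indices D (incident G r)"
        using er[OF r] incident_subset[of r] by (intro restrict_bond_indices[OF w]) auto
      then show "(\<Sum>j<d r. a r (restrict U (incident G r)) j * A r j (restrict (w(e := x')) (incident G r)))
        = (if restrict U (incident G r) = restrict w (incident G r) then 1 else 0)"
        using dual_A[OF _ Ur[OF r]] r er[OF r] by (simp add: transfer_def)
    qed
    also have "\<dots> = (if w = U then 1 else 0)"
    proof (cases "w = U")
      case False
      then obtain g where g: "g \<in> arcs G - {e}" "w g \<noteq> U g"
        using U w by (meson PiE_ext)
      obtain r where r: "r \<in> verts G" "r \<noteq> s" "r \<noteq> t" "g \<in> incident G r"
        using third_endpoint[OF _ _ st es et] g by (metis DiffD1 DiffD2 singletonI)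
      \<comment> \<open>A bond other than \<open>e\<close> where \<open>w\<close> and
        \<open>U\<close> differ is seen by the third vertex \<open>r\<close>, so the product over
        the vertices off \<open>s\<close> and \<open>t\<close> already pins
        \<open>w\<close>.\<close>
      have "restrict U (incident G r) \<noteq> restrict w (incident G r)"
        using g r by (metis restrict_apply')
      then have "(\<Prod>r\<in>verts G - {s, t}. if restrict U (incident G r) = restrict w (incident G r) then 1 else 0 :: complex) = 0"
        using r by (intro prod_zero) auto
      then show ?thesis using False by simp
    qed simp
    finally have 3: "(\<Prod>r\<in>verts G - {s, t}. \<Sum>j<d r. a r (restrict U (incident G r)) j *
        A r j (restrict (w(e := x')) (incident G r))) = (if w = U then 1 else 0)" .
    show "(\<Prod>r\<in>verts G. \<Sum>j<d r. f r j * A r j (restrict (w(e := x')) (incident G r)))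
       = (if w = U then (if x = x' then P else 0) else 0)"
      unfolding split 1 2 3 by (simp add: P_def os_def ot_def)
  qed
  also have "\<dots> = P" using U x by (simp add: finite_index)
  finally have "P = (\<Sum>w\<in>bond_indices D' (arcs G). \<Prod>r\<in>verts G. \<Sum>j<d r. f r j * B r j (restrict w (incident G r)))"
    unfolding contract_eq ..
  also have "\<dots> = (\<Sum>c'<D' e. \<Sum>w\<in>bond_indices D' (arcs G - {e}).
          \<Prod>r\<in>verts G. \<Sum>j<d r. f r j * B r j (restrict (w(e := c')) (incident G r)))"
    using sum_PiE_split[OF e] .
  also have "\<dots> = (\<Sum>w\<in>bond_indices D' (arcs G - {e}). \<Sum>c'<D' e.
          \<Prod>r\<in>verts G. \<Sum>j<d r. f r j * B r j (restrict (w(e := c')) (incident G r)))"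
    by (rule sum.swap)
  \<comment> \<open>In the second network the dual family \<open>b t\<close> fixes the bond
    \<open>e\<close> at \<open>c\<close> and the other bonds at \<open>t\<close> at
    \<open>y0\<close>; the bonds away from \<open>t\<close> stay summed.\<close>
  also have "\<dots> = (\<Sum>w\<in>bond_indices D' (arcs G - {e}). \<Sum>c'<D' e. if c = c' then
       M s (z(e := x)) ((restrict w os)(e := c')) * (if restrict w ot = y0
         then \<Prod>r\<in>verts G - {s, t}. M r (restrict U (incident G r)) (restrict w (incident G r)) else 0) else 0)"
  proof (intro sum.cong refl)
    fix c' w assume c': "c' \<in> {..<D' e}" and w: "w \<in> bond_indices D' (arcs G - {e})"
    have wot: "restrict w ot \<in> bond_indices D' ot" using w ot by (rule restrict_bond_indices)
    have m: "(restrict w ot)(e := c') \<in> bond_indices D' (incident G t)"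
      by (rule fun_upd_bond_indices[OF wot[unfolded ot_def] et, folded ot_def]) (use c' in simp)
    have "(\<Sum>j<d t. b t (y0(e := c)) j * B t j (restrict (w(e := c')) (incident G t))) = transfer d b B t (y0(e := c)) ((restrict w ot)(e := c'))"
      unfolding restrict_fun_upd_in[OF et] ot_def[symmetric] transfer_def ..
    also have "\<dots> = (if y0(e := c) = (restrict w ot)(e := c') then 1 else 0)"
      by (rule dual_B[OF t yc m])
    also have "y0(e := c) = (restrict w ot)(e := c') \<longleftrightarrow> y0 = restrict w ot \<and> c = c'"
      using fun_upd_eq_iff_PiE[OF y0 wot[unfolded ot_def]] unfolding ot_def .
    finally have 1: "(\<Sum>j<d t. b t (y0(e := c)) j * B t j (restrict (w(e := c')) (incident G t)))
      = (if y0 = restrict w ot \<and> c = c' then 1 else 0)" .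
    have 2: "(\<Sum>j<d s. a s (z(e := x)) j * B s j (restrict (w(e := c')) (incident G s)))
      = M s (z(e := x)) ((restrict w os)(e := c'))"
      unfolding restrict_fun_upd_in[OF es] os_def[symmetric] transfer_def ..
    have 3: "(\<Prod>r\<in>verts G - {s, t}. \<Sum>j<d r. a r (restrict U (incident G r)) j * B r j (restrict (w(e := c')) (incident G r)))
       = (\<Prod>r\<in>verts G - {s, t}. M r (restrict U (incident G r)) (restrict w (incident G r)))"
      by (intro prod.cong refl) (simp add: er transfer_def)
    show "(\<Prod>r\<in>verts G. \<Sum>j<d r. f r j * B r j (restrict (w(e := c')) (incident G r)))
      = (if c = c' then M s (z(e := x)) ((restrict w os)(e := c')) * (if restrict w ot = y0
         then \<Prod>r\<in>verts G - {s, t}. M r (restrict U (incident G r)) (restrict w (incident G r)) else 0) else 0)"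
      unfolding split 1 2 3 by auto
  qed
  also have "\<dots> = ?R" using c by (simp add: os_def ot_def)
  finally show ?thesis unfolding P_def .
qed

text \<open>This is \<open>M s (1 \<otimes> Y) = n \<otimes> 1\<close>, where \<open>n\<close> is a
  nonzero block of \<open>N t\<close>, obtained by freezing the bonds at \<open>t\<close> other than
  \<open>e\<close>. It is \<open>edge_identity\<close> with the sum over \<open>w\<close> grouped by
  the bonds at \<open>s\<close>.\<close>

lemma one_sided_factorization:
  assumes st: "s \<noteq> t" and es: "e \<in> incident G s" and et: "e \<in> incident G t"
  obtains y0 u0 Y where "y0 \<in> bond_indices D' (incident G t - {e})"
    "u0 \<in> bond_indices D (incident G t - {e})"
    "\<exists>x\<in>{..<D e}. \<exists>c\<in>{..<D' e}. N t (y0(e := c)) (u0(e := x)) \<noteq> 0"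
    "\<And>x z c \<zeta>. \<lbrakk>x < D e; z \<in> bond_indices D (incident G s - {e}); c < D' e;
        \<zeta> \<in> bond_indices D (incident G s - {e})\<rbrakk> \<Longrightarrow>
      (\<Sum>y\<in>bond_indices D' (incident G s - {e}). M s (z(e := x)) (y(e := c)) * Y y \<zeta>)
        = (if z = \<zeta> then N t (y0(e := c)) (u0(e := x)) else 0)"
proof -
  define os where "os = incident G s - {e}"
  define ot where "ot = incident G t - {e}"
  have e: "e \<in> arcs G" using es incident_subset by auto
  have s: "s \<in> verts G" and t: "t \<in> verts G" using es et in_incident_vert by auto
  have os: "os \<subseteq> arcs G - {e}" and ot: "ot \<subseteq> arcs G - {e}"
    using incident_subset by (auto simp: os_def ot_def)
  have disj: "os \<inter> ot = {}"
    using incident_both_eq[OF st es et] by (auto simp: os_def ot_def)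
  have "bond_indices D (incident G t) \<noteq> {}"
    using incident_subset[of t] by (intro index_nonempty D_pos) auto
  then obtain v where v: "v \<in> bond_indices D (incident G t)" by blast
  obtain w where w: "w \<in> bond_indices D' (incident G t)" "N t w v \<noteq> 0"
  proof -
    have "(\<Sum>w\<in>bond_indices D' (incident G t). M t v w * N t w v) \<noteq> 0"
      using M_N[OF t v v] by simp
    then show thesis using that by (metis (no_types, lifting) mult_zero_right sum.neutral)
  qed
  define y0 where "y0 = restrict w ot"
  define u0 where "u0 = restrict v ot"
  have ot_sub: "ot \<subseteq> incident G t" by (auto simp: ot_def)
  have y0: "y0 \<in> bond_indices D' ot"
    unfolding y0_def by (rule restrict_bond_indices[OF w(1) ot_sub])
  have u0: "u0 \<in> bond_indices D ot"
    unfolding u0_def by (rule restrict_bond_indices[OF v ot_sub])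
  have "y0(e := w e) = w" "u0(e := v e) = v"
    using restrict_fun_upd_in[OF et, of w "w e"] restrict_fun_upd_in[OF et, of v "v e"]
      PiE_restrict[OF w(1)] PiE_restrict[OF v] by (simp_all only: y0_def u0_def ot_def fun_upd_triv)
  moreover have "w e < D' e" "v e < D e" using w v et by auto
  ultimately have nz: "\<exists>x\<in>{..<D e}. \<exists>c\<in>{..<D' e}. N t (y0(e := c)) (u0(e := x)) \<noteq> 0"
    using w by (intro bexI[of _ "v e"] bexI[of _ "w e"]) simp_all
  \<comment> \<open>The values \<open>\<zeta>\<close> at \<open>s\<close> and \<open>u0\<close> at
    \<open>t\<close> can be imposed together because \<open>os\<close> and \<open>ot\<close> are
    disjoint. The value 0 elsewhere is arbitrary but admissible, as bond dimensions are
    positive.\<close>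
  define U where "U \<zeta> = (\<lambda>f\<in>arcs G - {e}. if f \<in> os then \<zeta> f else if f \<in> ot then u0 f else 0)"
    for \<zeta> :: "'e \<Rightarrow> nat"
  have U: "U \<zeta> \<in> bond_indices D (arcs G - {e})" if "\<zeta> \<in> bond_indices D os" for \<zeta>
    unfolding U_def restrict_PiE_iff
    using PiE_mem[OF that] PiE_mem[OF u0] D_pos by (intro ballI) (simp split: if_split)
  have Us: "restrict (U \<zeta>) os = \<zeta>" if "\<zeta> \<in> bond_indices D os" for \<zeta>
  proof
    fix f show "restrict (U \<zeta>) os f = \<zeta> f"
      using os PiE_arb[OF that, of f] by (cases "f \<in> os") (auto simp: U_def)
  qed
  have Ut: "restrict (U \<zeta>) ot = u0" for \<zeta>
  proof
    fix f show "restrict (U \<zeta>) ot f = u0 f"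
      using ot disj PiE_arb[OF u0, of f] by (cases "f \<in> ot") (auto simp: U_def)
  qed
  define Q where "Q w \<zeta> = (if restrict w ot = y0
    then \<Prod>r\<in>verts G - {s, t}. M r (restrict (U \<zeta>) (incident G r)) (restrict w (incident G r)) else 0)"
    for w \<zeta>
  \<comment> \<open>\<open>Y\<close> is the part of the network beyond \<open>s\<close> and
    \<open>e\<close>. It does not involve \<open>x\<close>, \<open>c\<close> or \<open>z\<close>,
    which is what makes the relation a factorization.\<close>
  define Y where "Y y \<zeta> = (\<Sum>w\<in>{w \<in> bond_indices D' (arcs G - {e}). restrict w os = y}. Q w \<zeta>)" for y \<zeta>
  have "(\<Sum>y\<in>bond_indices D' os. M s (z(e := x)) (y(e := c)) * Y y \<zeta>)
        = (if z = \<zeta> then N t (y0(e := c)) (u0(e := x)) else 0)"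
    if "x < D e" "z \<in> bond_indices D os" "c < D' e" "\<zeta> \<in> bond_indices D os" for x z c \<zeta>
  proof -
    have "(\<Sum>y\<in>bond_indices D' os. M s (z(e := x)) (y(e := c)) * Y y \<zeta>)
      = (\<Sum>y\<in>bond_indices D' os. \<Sum>w\<in>{w \<in> bond_indices D' (arcs G - {e}). restrict w os = y}.
          M s (z(e := x)) ((restrict w os)(e := c)) * Q w \<zeta>)"
      unfolding Y_def sum_distrib_left by (intro sum.cong refl, drule CollectD) (simp only:)
    also have "\<dots> = (\<Sum>w\<in>bond_indices D' (arcs G - {e}). M s (z(e := x)) ((restrict w os)(e := c)) * Q w \<zeta>)"
    proof (rule sum.group)
      show "finite (bond_indices D' (arcs G - {e}))" by (intro finite_index) simp
      show "finite (bond_indices D' os)" by (intro finite_index) (simp add: os_def)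
      show "(\<lambda>w. restrict w os) ` bond_indices D' (arcs G - {e}) \<subseteq> bond_indices D' os"
        using restrict_bond_indices[OF _ os] by (intro image_subsetI)
    qed
    also have "\<dots> = (if z = restrict (U \<zeta>) os then N t (y0(e := c)) ((restrict (U \<zeta>) ot)(e := x)) else 0)"
      unfolding Q_def os_def ot_def
      by (rule edge_identity[OF st es et that(2)[unfolded os_def] that(1) y0[unfolded ot_def] that(3)
            U[OF that(4)], symmetric])
    finally show ?thesis unfolding Us[OF that(4)] Ut .
  qed
  then show thesis
    unfolding os_def by (rule that[OF y0[unfolded ot_def] u0[unfolded ot_def] nz])
qed

end

subsection \<open>Products over edges and scalars at the vertices\<close>

text \<open>If a factor splits off at each single edge, all of them split off together: starting
  from a reference pair with nonzero value, the coordinates are exchanged one edge at a time, and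
  \<open>C\<close> is the value at the reference pair divided by its edge factors.\<close>

lemma product_form:
  fixes f :: "('e \<Rightarrow> nat) \<Rightarrow> ('e \<Rightarrow> nat) \<Rightarrow> 'a::field"
  assumes S: "finite S"
    and f: "\<And>e. e \<in> S \<Longrightarrow> \<exists>m. \<forall>x<D e. \<forall>c<D' e. \<forall>z\<in>bond_indices D (S - {e}). \<forall>y\<in>bond_indices D' (S - {e}).
      f (z(e := x)) (y(e := c)) = k e x c * m z y"
  obtains C where "\<And>u w. \<lbrakk>u \<in> bond_indices D S; w \<in> bond_indices D' S\<rbrakk> \<Longrightarrow> f u w = C * (\<Prod>e\<in>S. k e (u e) (w e))"
proof (cases "\<exists>u\<in>bond_indices D S. \<exists>w\<in>bond_indices D' S. f u w \<noteq> 0")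
  case False
  then show thesis using that[of 0] by simp
next
  case True
  then obtain u0 w0 where u0: "u0 \<in> bond_indices D S" and w0: "w0 \<in> bond_indices D' S"
    and nz: "f u0 w0 \<noteq> 0" by blast
  \<comment> \<open>The cofactor \<open>m\<close> is eliminated by cross-multiplication, since
    \<open>k e x c\<close> may be zero.\<close>
  have step: "f u w * k e x c = k e (u e) (w e) * f (u(e := x)) (w(e := c))"
    and fac: "f u w \<noteq> 0 \<Longrightarrow> k e (u e) (w e) \<noteq> 0"
    if e: "e \<in> S" and u: "u \<in> bond_indices D S" and w: "w \<in> bond_indices D' S" and x: "x < D e" and c: "c < D' e"
    for e u w x c
  proof -
    obtain m where m: "\<And>x c z y. \<lbrakk>x < D e; c < D' e; z \<in> bond_indices D (S - {e}); y \<in> bond_indices D' (S - {e})\<rbrakk> \<Longrightarrow>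
      f (z(e := x)) (y(e := c)) = k e x c * m z y" using f[OF e] by blast
    define z where "z = restrict u (S - {e})"
    define y where "y = restrict w (S - {e})"
    have z: "z \<in> bond_indices D (S - {e})" unfolding z_def by (rule restrict_PiE_iff[THEN iffD2]) (use u in auto)
    have y: "y \<in> bond_indices D' (S - {e})" unfolding y_def by (rule restrict_PiE_iff[THEN iffD2]) (use w in auto)
    have uz: "u(e := x) = z(e := x)" for x
    proof
      fix g show "(u(e := x)) g = (z(e := x)) g"
        using PiE_arb[OF u, of g] by (cases "g = e"; cases "g \<in> S") (simp_all add: z_def)
    qed
    have wy: "w(e := x) = y(e := x)" for x
    proof
      fix g show "(w(e := x)) g = (y(e := x)) g"
        using PiE_arb[OF w, of g] by (cases "g = e"; cases "g \<in> S") (simp_all add: y_def)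
    qed
    have ue: "u e < D e" and we: "w e < D' e" using u w e by auto
    have 1: "f u w = k e (u e) (w e) * m z y"
      using m[OF ue we z y] uz[of "u e"] wy[of "w e"] by simp
    have 2: "f (u(e := x)) (w(e := c)) = k e x c * m z y"
      using m[OF x c z y] unfolding uz wy .
    show "f u w * k e x c = k e (u e) (w e) * f (u(e := x)) (w(e := c))"
      unfolding 1 2 by (simp add: mult_ac)
    show "f u w \<noteq> 0 \<Longrightarrow> k e (u e) (w e) \<noteq> 0" using 1 by auto
  qed
  have k0: "k e (u0 e) (w0 e) \<noteq> 0" if "e \<in> S" for e
    using fac[OF that u0 w0, of "u0 e" "w0 e"] nz u0 w0 that by auto
  \<comment> \<open>\<open>T\<close> is the set of edges already switched to the reference
    values.\<close>
  have main: "f u w * (\<Prod>e\<in>T. k e (u0 e) (w0 e))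
      = (\<Prod>e\<in>T. k e (u e) (w e)) * f (override_on u u0 T) (override_on w w0 T)"
    if u: "u \<in> bond_indices D S" and w: "w \<in> bond_indices D' S" and T: "T \<subseteq> S" for u w T
    using finite_subset[OF T S] T
  proof (induction T rule: finite_induct)
    case empty
    show ?case by (simp add: override_on_def)
  next
    case (insert e T)
    have e: "e \<in> S" "e \<notin> T" using insert by auto
    let ?u = "override_on u u0 T" and ?w = "override_on w w0 T"
    have in_S: "override_on g h T \<in> bond_indices F S"
      if g: "g \<in> bond_indices F S" and h: "h \<in> bond_indices F S" for F g h
    proof (rule PiE_I)
      show "override_on g h T x \<in> {..<F x}" if "x \<in> S" for x
        using PiE_mem[OF g that] PiE_mem[OF h that] by (cases "x \<in> T") simp_all
      show "override_on g h T x = undefined" if "x \<notin> S" for x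
        using PiE_arb[OF g that] that insert.prems by (subst override_on_apply_notin) auto
    qed
    have uT: "?u \<in> bond_indices D S" and wT: "?w \<in> bond_indices D' S"
      using in_S u u0 w w0 by blast+
    have xe: "u0 e < D e" "w0 e < D' e" using u0 w0 e by auto
    have ins: "override_on g h (insert e T) = (override_on g h T)(e := h e)" for g h :: "'e \<Rightarrow> nat"
      by (auto simp: override_on_def fun_eq_iff)
    have "f u w * (\<Prod>e\<in>insert e T. k e (u0 e) (w0 e)) = f u w * (\<Prod>e\<in>T. k e (u0 e) (w0 e)) * k e (u0 e) (w0 e)"
      using insert.hyps by (simp add: mult_ac)
    also have "\<dots> = (\<Prod>e\<in>T. k e (u e) (w e)) * (f ?u ?w * k e (u0 e) (w0 e))"
      using insert by (simp add: mult_ac)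
    also have "f ?u ?w * k e (u0 e) (w0 e) = k e (u e) (w e) * f (?u(e := u0 e)) (?w(e := w0 e))"
      using step[OF e(1) uT wT xe] e(2) by (simp add: override_on_def)
    also have "(\<Prod>e\<in>T. k e (u e) (w e)) * (k e (u e) (w e) * f (?u(e := u0 e)) (?w(e := w0 e)))
      = (\<Prod>e\<in>insert e T. k e (u e) (w e)) * f (?u(e := u0 e)) (?w(e := w0 e))"
      unfolding prod.insert[OF insert.hyps] mult.assoc by (rule mult.left_commute)
    finally show ?case unfolding ins .
  qed
  have "f u w = f u0 w0 / (\<Prod>e\<in>S. k e (u0 e) (w0 e)) * (\<Prod>e\<in>S. k e (u e) (w e))"
    if u: "u \<in> bond_indices D S" and w: "w \<in> bond_indices D' S" for u w
  proof -
    have ov: "override_on g h S = h" if g: "g \<in> bond_indices F S" and h: "h \<in> bond_indices F S" for F g h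
    proof
      fix x show "override_on g h S x = h x"
        using PiE_arb[OF g, of x] PiE_arb[OF h, of x] by (cases "x \<in> S") simp_all
    qed
    have "override_on u u0 S = u0" "override_on w w0 S = w0"
      using ov[OF u u0] ov[OF w w0] .
    then show ?thesis using main[OF u w subset_refl] k0 S by (simp add: field_simps)
  qed
  then show thesis by (rule that)
qed

section \<open>Vertex scalars produced by rescaling edges\<close>

context simple_graph
begin

text \<open>Each edge is counted exactly twice, once at either end, as there are no loops.\<close>

lemma prod_incident:
  "(\<Prod>s\<in>verts G. \<Prod>e\<in>incident G s. g s e) = (\<Prod>e\<in>arcs G. g (tail G e) e * g (head G e) e)"
  for g :: "'v \<Rightarrow> 'e \<Rightarrow> 'a::comm_monoid_mult"
proof -
  have "(\<Prod>s\<in>verts G. \<Prod>e\<in>incident G s. g s e)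
     = (\<Prod>e\<in>arcs G. \<Prod>s\<in>{s \<in> verts G. tail G e = s \<or> head G e = s}. g s e)"
    unfolding incident_def by (rule prod.swap_restrict) auto
  also have "\<dots> = (\<Prod>e\<in>arcs G. g (tail G e) e * g (head G e) e)"
  proof (intro prod.cong refl)
    fix e assume e: "e \<in> arcs G"
    then have "{s \<in> verts G. tail G e = s \<or> head G e = s} = {tail G e, head G e}" by auto
    then show "(\<Prod>s\<in>{s \<in> verts G. tail G e = s \<or> head G e = s}. g s e) = g (tail G e) e * g (head G e) e"
      using no_loops[OF e] by simp
  qed
  finally show ?thesis .
qed

text \<open>A multiplicative divergence of a flow: rescaling every gauge matrix \<open>Z e\<close>
  by a nonzero \<open>z e\<close> multiplies the gauge action at \<open>s\<close> by this
  factor.\<close>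

definition divergence :: "('e \<Rightarrow> complex) \<Rightarrow> 'v \<Rightarrow> complex" where
  "divergence z s = (\<Prod>e\<in>incident G s. if tail G e = s then z e else inverse (z e))"

definition realizable :: "('v \<Rightarrow> complex) \<Rightarrow> bool" where
  "realizable c \<longleftrightarrow> (\<exists>z. (\<forall>e. z e \<noteq> 0) \<and> (\<forall>s\<in>verts G. divergence z s = c s))"

lemma realizable_one: "realizable (\<lambda>s. 1)"
  unfolding realizable_def divergence_def by (intro exI[of _ "\<lambda>e. 1"] conjI ballI prod.neutral) auto

lemma realizable_mult:
  assumes "realizable c" "realizable c'"
  shows "realizable (\<lambda>s. c s * c' s)"
proof -
  obtain z z' where z: "\<forall>e. z e \<noteq> 0" "\<forall>e. z' e \<noteq> 0"
    "\<forall>s\<in>verts G. divergence z s = c s" "\<forall>s\<in>verts G. divergence z' s = c' s"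
    using assms unfolding realizable_def by blast
  have "divergence (\<lambda>e. z e * z' e) s = divergence z s * divergence z' s" for s
    unfolding divergence_def prod.distrib[symmetric] by (intro prod.cong) auto
  then show ?thesis
    unfolding realizable_def using z by (intro exI[of _ "\<lambda>e. z e * z' e"]) auto
qed

lemma realizable_cong:
  assumes "realizable c" "\<And>s. s \<in> verts G \<Longrightarrow> c s = c' s"
  shows "realizable c'"
  using assms unfolding realizable_def by auto

lemma realizable_prod:
  assumes "finite I" "\<And>i. i \<in> I \<Longrightarrow> realizable (c i)"
  shows "realizable (\<lambda>s. \<Prod>i\<in>I. c i s)"
  using assms by (induction I rule: finite_induct) (auto simp: realizable_one intro: realizable_mult)

text \<open>Moves the scalar \<open>q\<close> from \<open>t\<close> to \<open>s\<close>. Keeping the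
  two factors separate makes it trivial for \<open>s = t\<close> and \<open>q \<noteq> 0\<close>,
  and lets consecutive transports along a path telescope.\<close>

definition transport :: "complex \<Rightarrow> 'v \<Rightarrow> 'v \<Rightarrow> 'v \<Rightarrow> complex" where
  "transport q s t v = (if v = s then q else 1) * (if v = t then inverse q else 1)"

lemma realizable_transport_arc:
  assumes e: "e \<in> arcs G" and q: "q \<noteq> 0"
  shows "realizable (transport q (tail G e) (head G e))"
proof -
  define z where "z f = (if f = e then q else 1)" for f
  have "divergence z s = transport q (tail G e) (head G e) s" if "s \<in> verts G" for s
  proof (cases "e \<in> incident G s")
    case True
    have "divergence z s = (if tail G e = s then q else inverse q) *
        (\<Prod>f\<in>incident G s - {e}. if tail G f = s then z f else inverse (z f))"
      using True by (simp add: divergence_def prod.remove[of _ e] z_def)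
    also have "(\<Prod>f\<in>incident G s - {e}. if tail G f = s then z f else inverse (z f)) = 1"
      by (intro prod.neutral) (auto simp: z_def)
    finally show ?thesis using True no_loops[OF e] by (auto simp: transport_def incident_def)
  next
    case False
    have "divergence z s = 1"
      unfolding divergence_def using False by (intro prod.neutral) (auto simp: z_def)
    then show ?thesis using False e by (auto simp: transport_def incident_def)
  qed
  moreover have "\<forall>f. z f \<noteq> 0" using q by (simp add: z_def)
  ultimately show ?thesis unfolding realizable_def by blast
qed

text \<open>Transports along the arcs of an undirected path multiply to the transport between its
  ends; an arc traversed backwards is rescaled by \<open>inverse q\<close>.\<close>

lemma realizable_transport:
  assumes "(s, t) \<in> (arcs_ends (mk_symmetric G))\<^sup>*" and q: "q \<noteq> 0"
  shows "realizable (transport q s t)"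
  using assms(1)
proof (induction rule: rtrancl_induct)
  case base
  show ?case by (rule realizable_cong[OF realizable_one]) (simp add: transport_def q)
next
  case (step t r)
  have "realizable (transport q t r)"
  proof -
    obtain e where e: "e \<in> arcs G" "(t, r) = (tail G e, head G e) \<or> (t, r) = (head G e, tail G e)"
      using step.hyps(2) by (auto simp: arcs_ends_def arc_to_ends_def mk_symmetric_def)
    from e(2) show ?thesis
    proof
      assume "(t, r) = (tail G e, head G e)"
      then show ?thesis using realizable_transport_arc[OF e(1) q] by simp
    next
      assume "(t, r) = (head G e, tail G e)"
      moreover have "realizable (transport (inverse q) (tail G e) (head G e))"
        using realizable_transport_arc[OF e(1)] q by simp
      ultimately show ?thesis by (auto elim!: realizable_cong simp: transport_def)
    qed
  qed
  from realizable_mult[OF step.IH this] show ?case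
    by (rule realizable_cong) (simp add: transport_def q)
qed

text \<open>Every scalar \<open>c s\<close> is produced at \<open>s\<close> at the expense of a
  fixed root \<open>r\<close>. The root thereby collects the inverse of the product of all
  \<open>c s\<close>, which is 1.\<close>

lemma connected_realizable:
  assumes conn: "Digraph_Component.connected G" and nz: "\<And>s. s \<in> verts G \<Longrightarrow> c s \<noteq> 0"
    and one: "(\<Prod>s\<in>verts G. c s) = 1"
  shows "realizable c"
proof -
  have sc: "strongly_connected (mk_symmetric G)"
    using conn unfolding Digraph_Component.connected_def .
  then obtain r where r: "r \<in> verts G"
    unfolding strongly_connected_def by (auto simp: mk_symmetric_def)
  have "realizable (transport (c s) s r)" if s: "s \<in> verts G" for s
  proof (rule realizable_transport[OF _ nz[OF s]])
    have "s \<rightarrow>\<^sup>*\<^bsub>mk_symmetric G\<^esub> r"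
      using sc s r unfolding strongly_connected_def by (simp add: mk_symmetric_def)
    then show "(s, r) \<in> (arcs_ends (mk_symmetric G))\<^sup>*"
      unfolding reachable_def by (rule rtrancl_on_rtranclI)
  qed
  then have "realizable (\<lambda>v. \<Prod>s\<in>verts G. transport (c s) s r v)"
    by (intro realizable_prod) auto
  then show ?thesis
  proof (rule realizable_cong)
    fix v assume v: "v \<in> verts G"
    have "(\<Prod>s\<in>verts G. transport (c s) s r v)
      = (\<Prod>s\<in>verts G. if v = s then c s else 1) * (\<Prod>s\<in>verts G. if v = r then inverse (c s) else 1)"
      by (simp add: transport_def prod.distrib)
    also have "(\<Prod>s\<in>verts G. if v = s then c s else 1) = c v" using v by simp
    also have "(\<Prod>s\<in>verts G. if v = r then inverse (c s) else 1) = 1"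
    proof -
      have "(\<Prod>s\<in>verts G. inverse (c s)) = inverse (\<Prod>s\<in>verts G. c s)"
        using prod_inversef[of c "verts G"] by (simp only: comp_def)
      then show ?thesis using one by (cases "v = r") simp_all
    qed
    finally show "(\<Prod>s\<in>verts G. transport (c s) s r v) = c v" by simp
  qed
qed

end

section \<open>Transfer matrices as products of edge matrices\<close>

context equal_state_peps
begin

text \<open>The one-sided relations for \<open>M s\<close> and \<open>N s\<close> feed
  \<open>tensor_factorization\<close>. The last conclusion keeps \<open>n\<close> as a block of
  \<open>N t\<close>, which later links the factors found at the two ends of
  \<open>e\<close>.\<close>

lemma vertex_factorization:
  assumes st: "s \<noteq> t" and es: "e \<in> incident G s" and et: "e \<in> incident G t"
  obtains n n' l m m' y0 u0 where "l \<noteq> 0"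
    "\<And>x x'. \<lbrakk>x < D e; x' < D e\<rbrakk> \<Longrightarrow> (\<Sum>c<D' e. n x c * n' c x') = (if x = x' then l else 0)"
    "\<And>c c'. \<lbrakk>c < D' e; c' < D' e\<rbrakk> \<Longrightarrow> (\<Sum>x<D e. n' c x * n x c') = (if c = c' then l else 0)"
    "\<And>x z c y. \<lbrakk>x < D e; z \<in> bond_indices D (incident G s - {e}); c < D' e; y \<in> bond_indices D' (incident G s - {e})\<rbrakk>
      \<Longrightarrow> M s (z(e := x)) (y(e := c)) = n x c * m z y"
    "\<And>x z c y. \<lbrakk>x < D e; z \<in> bond_indices D (incident G s - {e}); c < D' e; y \<in> bond_indices D' (incident G s - {e})\<rbrakk>
      \<Longrightarrow> N s (y(e := c)) (z(e := x)) = n' c x * m' y z"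
    "y0 \<in> bond_indices D' (incident G t - {e})" "u0 \<in> bond_indices D (incident G t - {e})"
    "\<And>x c. n x c = N t (y0(e := c)) (u0(e := x))"
proof -
  define os where "os = incident G s - {e}"
  have e: "e \<in> arcs G" using es incident_subset by auto
  have s: "s \<in> verts G" using es in_incident_vert by auto
  have fin: "finite (bond_indices D os)" "finite (bond_indices D' os)"
    by (simp_all add: os_def finite_index)
  have ne: "bond_indices D os \<noteq> {}"
    using incident_subset[of s] D_pos unfolding os_def by (intro index_nonempty) auto
  have upd: "z(e := x) \<in> bond_indices D (incident G s)" if "x < D e" "z \<in> bond_indices D os" for x z
    using fun_upd_bond_indices[OF that(2)[unfolded os_def] es that(1)] .
  have upd': "z(e := x) \<in> bond_indices D' (incident G s)" if "x < D' e" "z \<in> bond_indices D' os" for x z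
    using fun_upd_bond_indices[OF that(2)[unfolded os_def] es that(1)] .
  have MN: "(\<Sum>c\<in>{..<D' e}. \<Sum>y\<in>bond_indices D' os. M s (z(e := x)) (y(e := c)) * N s (y(e := c)) (z'(e := x')))
      = (if x = x' \<and> z = z' then 1 else 0)"
    if "x \<in> {..<D e}" "z \<in> bond_indices D os" "x' \<in> {..<D e}" "z' \<in> bond_indices D os" for x z x' z'
  proof -
    have x: "x < D e" "x' < D e" using that by auto
    have "(\<Sum>w\<in>bond_indices D' (incident G s). M s (z(e := x)) w * N s w (z'(e := x')))
      = (if z(e := x) = z'(e := x') then 1 else 0)"
      by (rule M_N[OF s upd[OF x(1) that(2)] upd[OF x(2) that(4)]])
    also have "z(e := x) = z'(e := x') \<longleftrightarrow> x = x' \<and> z = z'"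
      using fun_upd_eq_iff_PiE[OF that(2)[unfolded os_def] that(4)[unfolded os_def]] by blast
    finally show ?thesis unfolding sum_PiE_split[OF es] os_def .
  qed
  have NM: "(\<Sum>x\<in>{..<D e}. \<Sum>z\<in>bond_indices D os. N s (y(e := c)) (z(e := x)) * M s (z(e := x)) (y'(e := c')))
      = (if c = c' \<and> y = y' then 1 else 0)"
    if "c \<in> {..<D' e}" "y \<in> bond_indices D' os" "c' \<in> {..<D' e}" "y' \<in> bond_indices D' os" for c y c' y'
  proof -
    have c: "c < D' e" "c' < D' e" using that by auto
    have "(\<Sum>w\<in>bond_indices D (incident G s). N s (y(e := c)) w * M s w (y'(e := c')))
      = (if y(e := c) = y'(e := c') then 1 else 0)"
      by (rule N_M[OF s upd'[OF c(1) that(2)] upd'[OF c(2) that(4)]])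
    also have "y(e := c) = y'(e := c') \<longleftrightarrow> c = c' \<and> y = y'"
      using fun_upd_eq_iff_PiE[OF that(2)[unfolded os_def] that(4)[unfolded os_def]] by blast
    finally show ?thesis unfolding sum_PiE_split[OF es] os_def .
  qed
  show thesis
  proof (rule one_sided_factorization[OF st es et, folded os_def],
      rule equal_state_peps.one_sided_factorization[OF swapped st es et, folded os_def])
    \<comment> \<open>\<open>y0\<close>, \<open>u0\<close>, \<open>Y\<close> belong to the relation
      for \<open>M s\<close>; \<open>y1\<close>, \<open>u1\<close>, \<open>Y'\<close> come from
      exchanging the two PEPS and belong to the relation for \<open>N s\<close>.\<close>
    fix y0 u0 Y y1 u1 Y'
    assume y0: "y0 \<in> bond_indices D' (incident G t - {e})"
      and u0: "u0 \<in> bond_indices D (incident G t - {e})"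
      and nz: "\<exists>x\<in>{..<D e}. \<exists>c\<in>{..<D' e}. N t (y0(e := c)) (u0(e := x)) \<noteq> 0"
      and Y: "\<And>x z c \<zeta>. \<lbrakk>x < D e; z \<in> bond_indices D os; c < D' e; \<zeta> \<in> bond_indices D os\<rbrakk> \<Longrightarrow>
        (\<Sum>y\<in>bond_indices D' os. M s (z(e := x)) (y(e := c)) * Y y \<zeta>)
          = (if z = \<zeta> then N t (y0(e := c)) (u0(e := x)) else 0)"
      and nz': "\<exists>c\<in>{..<D' e}. \<exists>x\<in>{..<D e}. M t (y1(e := x)) (u1(e := c)) \<noteq> 0"
      and Y': "\<And>c y x \<zeta>. \<lbrakk>c < D' e; y \<in> bond_indices D' os; x < D e; \<zeta> \<in> bond_indices D' os\<rbrakk> \<Longrightarrow>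
        (\<Sum>z\<in>bond_indices D os. N s (y(e := c)) (z(e := x)) * Y' z \<zeta>)
          = (if y = \<zeta> then M t (y1(e := x)) (u1(e := c)) else 0)"
    define n where "n x c = N t (y0(e := c)) (u0(e := x))" for x c
    define n' where "n' c x = M t (y1(e := x)) (u1(e := c))" for c x
    show thesis
    proof (rule tensor_factorization[of "{..<D e}" "bond_indices D os" "{..<D' e}" "bond_indices D' os"
        "\<lambda>x z c y. M s (z(e := x)) (y(e := c))" "\<lambda>c y x z. N s (y(e := c)) (z(e := x))" Y n Y' n',
        OF finite_lessThan fin(1) finite_lessThan fin(2) MN NM _ _ _ _ ne])
      show "(\<Sum>y\<in>bond_indices D' os. M s (z(e := x)) (y(e := c)) * Y y z') = (if z = z' then n x c else 0)"
        if "x \<in> {..<D e}" "z \<in> bond_indices D os" "c \<in> {..<D' e}" "z' \<in> bond_indices D os" for x z c z'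
        using Y[of x z c z'] that by (simp only: n_def lessThan_iff)
      show "(\<Sum>z\<in>bond_indices D os. N s (y(e := c)) (z(e := x)) * Y' z y') = (if y = y' then n' c x else 0)"
        if "x \<in> {..<D e}" "y \<in> bond_indices D' os" "c \<in> {..<D' e}" "y' \<in> bond_indices D' os" for x y c y'
        using Y'[of c y x y'] that by (simp only: n'_def lessThan_iff)
      show "\<exists>x\<in>{..<D e}. \<exists>c\<in>{..<D' e}. n x c \<noteq> 0" using nz unfolding n_def .
      show "\<exists>x\<in>{..<D e}. \<exists>c\<in>{..<D' e}. n' c x \<noteq> 0" using nz' unfolding n'_def by blast
      fix l assume l: "l \<noteq> 0"
        "\<And>x x'. \<lbrakk>x \<in> {..<D e}; x' \<in> {..<D e}\<rbrakk> \<Longrightarrow> (\<Sum>c\<in>{..<D' e}. n x c * n' c x') = (if x = x' then l else 0)"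
        "\<And>c c'. \<lbrakk>c \<in> {..<D' e}; c' \<in> {..<D' e}\<rbrakk> \<Longrightarrow> (\<Sum>x\<in>{..<D e}. n' c x * n x c') = (if c = c' then l else 0)"
        "\<And>x z c y. \<lbrakk>x \<in> {..<D e}; z \<in> bond_indices D os; c \<in> {..<D' e}; y \<in> bond_indices D' os\<rbrakk>
          \<Longrightarrow> M s (z(e := x)) (y(e := c)) = n x c * (Y' z y / l)"
        "\<And>x z c y. \<lbrakk>x \<in> {..<D e}; z \<in> bond_indices D os; c \<in> {..<D' e}; y \<in> bond_indices D' os\<rbrakk>
          \<Longrightarrow> N s (y(e := c)) (z(e := x)) = n' c x * (Y y z / l)"
      show thesis
        by (rule that[of l n n' "\<lambda>z y. Y' z y / l" "\<lambda>y z. Y y z / l",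
              OF l[unfolded lessThan_iff os_def] y0 u0 n_def])
    qed
  qed
qed

lemma edge_factorization:
  assumes st: "s \<noteq> t" and es: "e \<in> incident G s" and et: "e \<in> incident G t"
  obtains K K' m m' where
    "\<And>x x'. \<lbrakk>x < D e; x' < D e\<rbrakk> \<Longrightarrow> (\<Sum>c<D' e. K x c * K' c x') = (if x = x' then 1 else 0)"
    "\<And>c c'. \<lbrakk>c < D' e; c' < D' e\<rbrakk> \<Longrightarrow> (\<Sum>x<D e. K' c x * K x c') = (if c = c' then 1 else 0)"
    "\<And>x z c y. \<lbrakk>x < D e; z \<in> bond_indices D (incident G s - {e}); c < D' e; y \<in> bond_indices D' (incident G s - {e})\<rbrakk>
      \<Longrightarrow> M s (z(e := x)) (y(e := c)) = K x c * m z y"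
    "\<And>x z c y. \<lbrakk>x < D e; z \<in> bond_indices D (incident G t - {e}); c < D' e; y \<in> bond_indices D' (incident G t - {e})\<rbrakk>
      \<Longrightarrow> M t (z(e := x)) (y(e := c)) = K' c x * m' z y"
proof (rule vertex_factorization[OF st es et], rule vertex_factorization[OF st[symmetric] et es])
  fix ns ns' ls ms ms' y0 u0 n n' l m m' y1 u1
  assume y0: "y0 \<in> bond_indices D' (incident G t - {e})" and u0: "u0 \<in> bond_indices D (incident G t - {e})"
    and ns: "\<And>x c. ns x c = N t (y0(e := c)) (u0(e := x))"
    and Ms: "\<And>x z c y. \<lbrakk>x < D e; z \<in> bond_indices D (incident G s - {e}); c < D' e; y \<in> bond_indices D' (incident G s - {e})\<rbrakk>
      \<Longrightarrow> M s (z(e := x)) (y(e := c)) = ns x c * ms z y"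
    and Nt: "\<And>x z c y. \<lbrakk>x < D e; z \<in> bond_indices D (incident G t - {e}); c < D' e; y \<in> bond_indices D' (incident G t - {e})\<rbrakk>
      \<Longrightarrow> N t (y(e := c)) (z(e := x)) = n' c x * m' y z"
    and Mt: "\<And>x z c y. \<lbrakk>x < D e; z \<in> bond_indices D (incident G t - {e}); c < D' e; y \<in> bond_indices D' (incident G t - {e})\<rbrakk>
      \<Longrightarrow> M t (z(e := x)) (y(e := c)) = n x c * m z y"
    and l: "l \<noteq> 0"
    and nn': "\<And>x x'. \<lbrakk>x < D e; x' < D e\<rbrakk> \<Longrightarrow> (\<Sum>c<D' e. n x c * n' c x') = (if x = x' then l else 0)"
    and n'n: "\<And>c c'. \<lbrakk>c < D' e; c' < D' e\<rbrakk> \<Longrightarrow> (\<Sum>x<D e. n' c x * n x c') = (if c = c' then l else 0)"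
  show thesis
  \<comment> \<open>The factor \<open>ns\<close> at \<open>s\<close> is a block of
    \<open>N t\<close>, and \<open>N t\<close> itself factorizes, so
    \<open>ns x c = n' c x * m' y0 u0\<close>. The constant moves into the cofactor at
    \<open>s\<close>, and the factor \<open>n / l\<close> at \<open>t\<close> is inverse to
    \<open>n'\<close> after transposition.\<close>
  proof (rule that[of "\<lambda>x c. n' c x" "\<lambda>c x. n x c / l" "\<lambda>z y. m' y0 u0 * ms z y" "\<lambda>z y. l * m z y"])
    show "(\<Sum>c<D' e. n' c x * (n x' c / l)) = (if x = x' then 1 else 0)" if "x < D e" "x' < D e" for x x'
    proof -
      have "(\<Sum>c<D' e. n' c x * (n x' c / l)) = (\<Sum>c<D' e. n x' c * n' c x) / l"
        by (simp add: sum_divide_distrib mult.commute)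
      then show ?thesis using l nn'[OF that(2,1)] by auto
    qed
    show "(\<Sum>x<D e. n x c / l * n' c' x) = (if c = c' then 1 else 0)" if "c < D' e" "c' < D' e" for c c'
    proof -
      have "(\<Sum>x<D e. n x c / l * n' c' x) = (\<Sum>x<D e. n' c' x * n x c) / l"
        by (simp add: sum_divide_distrib mult.commute)
      then show ?thesis using l n'n[OF that(2,1)] by auto
    qed
    show "M s (z(e := x)) (y(e := c)) = n' c x * (m' y0 u0 * ms z y)"
      if "x < D e" "z \<in> bond_indices D (incident G s - {e})" "c < D' e" "y \<in> bond_indices D' (incident G s - {e})"
      for x z c y
      using Ms[OF that] ns[of x c] Nt[OF that(1) u0 that(3) y0] by (simp only: mult.assoc)
    show "M t (z(e := x)) (y(e := c)) = n x c / l * (l * m z y)"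
      if "x < D e" "z \<in> bond_indices D (incident G t - {e})" "c < D' e" "y \<in> bond_indices D' (incident G t - {e})"
      for x z c y
      unfolding Mt[OF that] using l by simp
  qed
qed

text \<open>Choosing mutually inverse matrices for each edge, \<open>K\<close> at the tail and
  \<open>K'\<close> at the head, leaves one scalar per vertex by \<open>product_form\<close>.
  Comparing a single coefficient of both networks shows that these scalars multiply to 1.\<close>

lemma gauge_factorization:
  obtains K K' C where
    "\<And>e x x'. \<lbrakk>e \<in> arcs G; x < D e; x' < D e\<rbrakk> \<Longrightarrow> (\<Sum>c<D' e. K e x c * K' e c x') = (if x = x' then 1 else 0)"
    "\<And>e c c'. \<lbrakk>e \<in> arcs G; c < D' e; c' < D' e\<rbrakk> \<Longrightarrow> (\<Sum>x<D e. K' e c x * K e x c') = (if c = c' then 1 else 0)"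
    "\<And>s u w. \<lbrakk>s \<in> verts G; u \<in> bond_indices D (incident G s); w \<in> bond_indices D' (incident G s)\<rbrakk> \<Longrightarrow>
      M s u w = C s * (\<Prod>e\<in>incident G s. if tail G e = s then K e (u e) (w e) else K' e (w e) (u e))"
    "\<And>s. s \<in> verts G \<Longrightarrow> C s \<noteq> 0"
    "(\<Prod>s\<in>verts G. C s) = 1"
proof -
  \<comment> \<open>Bundling the conclusions of \<open>edge_factorization\<close> lets all four
    objects be chosen simultaneously for every edge.\<close>
  define P where "P e K K' m m' \<longleftrightarrow>
    (\<forall>x<D e. \<forall>x'<D e. (\<Sum>c<D' e. K x c * K' c x') = (if x = x' then 1 else 0)) \<and>
    (\<forall>c<D' e. \<forall>c'<D' e. (\<Sum>x<D e. K' c x * K x c') = (if c = c' then 1 else 0)) \<and>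
    (\<forall>x<D e. \<forall>c<D' e. \<forall>z\<in>bond_indices D (incident G (tail G e) - {e}). \<forall>y\<in>bond_indices D' (incident G (tail G e) - {e}).
      M (tail G e) (z(e := x)) (y(e := c)) = K x c * m z y) \<and>
    (\<forall>x<D e. \<forall>c<D' e. \<forall>z\<in>bond_indices D (incident G (head G e) - {e}). \<forall>y\<in>bond_indices D' (incident G (head G e) - {e}).
      M (head G e) (z(e := x)) (y(e := c)) = K' c x * m' z y)" for e K K' m m'
  have "\<exists>K K' m m'. P e K K' m m'" if e: "e \<in> arcs G" for e
  proof -
    have te: "tail G e \<noteq> head G e" "e \<in> incident G (tail G e)" "e \<in> incident G (head G e)"
      using no_loops[OF e] e by (auto simp: incident_def)
    show ?thesis
    proof (rule edge_factorization[OF te])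
      fix K K' m m'
      assume 1: "\<And>x x'. \<lbrakk>x < D e; x' < D e\<rbrakk> \<Longrightarrow> (\<Sum>c<D' e. K x c * K' c x') = (if x = x' then 1 else 0)"
        and 2: "\<And>c c'. \<lbrakk>c < D' e; c' < D' e\<rbrakk> \<Longrightarrow> (\<Sum>x<D e. K' c x * K x c') = (if c = c' then 1 else 0)"
        and 3: "\<And>x z c y. \<lbrakk>x < D e; z \<in> bond_indices D (incident G (tail G e) - {e}); c < D' e; y \<in> bond_indices D' (incident G (tail G e) - {e})\<rbrakk>
          \<Longrightarrow> M (tail G e) (z(e := x)) (y(e := c)) = K x c * m z y"
        and 4: "\<And>x z c y. \<lbrakk>x < D e; z \<in> bond_indices D (incident G (head G e) - {e}); c < D' e; y \<in> bond_indices D' (incident G (head G e) - {e})\<rbrakk>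
          \<Longrightarrow> M (head G e) (z(e := x)) (y(e := c)) = K' c x * m' z y"
      have "P e K K' m m'"
        unfolding P_def by (intro conjI allI impI ballI; rule 1 2 3 4; assumption)
      then show ?thesis by blast
    qed
  qed
  then obtain K K' m m' where P: "\<And>e. e \<in> arcs G \<Longrightarrow> P e (K e) (K' e) (m e) (m' e)" by metis
  have K1: "(\<Sum>c<D' e. K e x c * K' e c x') = (if x = x' then 1 else 0)" if "e \<in> arcs G" "x < D e" "x' < D e" for e x x'
    using P[OF that(1), unfolded P_def, THEN conjunct1] that by blast
  have K2: "(\<Sum>x<D e. K' e c x * K e x c') = (if c = c' then 1 else 0)" if "e \<in> arcs G" "c < D' e" "c' < D' e" for e c c'
    using P[OF that(1), unfolded P_def, THEN conjunct2, THEN conjunct1] that by blast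
  define k where "k s e x c = (if tail G e = s then K e x c else K' e c x)" for s e x c
  have "\<forall>s\<in>verts G. \<exists>C. \<forall>u\<in>bond_indices D (incident G s). \<forall>w\<in>bond_indices D' (incident G s).
      M s u w = C * (\<Prod>e\<in>incident G s. k s e (u e) (w e))"
  proof
    fix s assume s: "s \<in> verts G"
    have fac: "\<exists>m. \<forall>x<D e. \<forall>c<D' e. \<forall>z\<in>bond_indices D (incident G s - {e}). \<forall>y\<in>bond_indices D' (incident G s - {e}).
      M s (z(e := x)) (y(e := c)) = k s e x c * m z y" if e: "e \<in> incident G s" for e
    proof (cases "tail G e = s")
      case True
      have "P e (K e) (K' e) (m e) (m' e)" using P e incident_subset by auto
      then show ?thesis unfolding P_def k_def True by (intro exI[of _ "m e"]) (simp only: simp_thms if_True, elim conjE, assumption)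
    next
      case False
      then have h: "head G e = s" using e by (auto simp: incident_def)
      have "P e (K e) (K' e) (m e) (m' e)" using P e incident_subset by auto
      then show ?thesis using False unfolding P_def k_def h
        by (intro exI[of _ "m' e"]) (simp only: simp_thms if_False, elim conjE, assumption)
    qed
    show "\<exists>C. \<forall>u\<in>bond_indices D (incident G s). \<forall>w\<in>bond_indices D' (incident G s).
      M s u w = C * (\<Prod>e\<in>incident G s. k s e (u e) (w e))"
    proof (rule product_form[of "incident G s" D D' "M s" "k s", OF finite_incident fac])
      fix C assume "\<And>u w. \<lbrakk>u \<in> bond_indices D (incident G s); w \<in> bond_indices D' (incident G s)\<rbrakk> \<Longrightarrow>
        M s u w = C * (\<Prod>e\<in>incident G s. k s e (u e) (w e))"
      then show ?thesis by (intro exI[of _ C] ballI)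
    qed
  qed
  from bchoice[OF this] obtain C where C': "\<forall>s\<in>verts G. \<forall>u\<in>bond_indices D (incident G s). \<forall>w\<in>bond_indices D' (incident G s).
      M s u w = C s * (\<Prod>e\<in>incident G s. k s e (u e) (w e))" ..
  have C: "\<And>s u w. \<lbrakk>s \<in> verts G; u \<in> bond_indices D (incident G s); w \<in> bond_indices D' (incident G s)\<rbrakk> \<Longrightarrow>
      M s u w = C s * (\<Prod>e\<in>incident G s. k s e (u e) (w e))" for s u w
    by (rule C'[rule_format])
  have C0: "C s \<noteq> 0" if s: "s \<in> verts G" for s
  proof
    assume "C s = 0"
    have "bond_indices D (incident G s) \<noteq> {}"
      using incident_subset[of s] by (intro index_nonempty D_pos) auto
    then obtain v where v: "v \<in> bond_indices D (incident G s)" by blast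
    have "(\<Sum>w\<in>bond_indices D' (incident G s). M s v w * N s w v) = 0"
      by (intro sum.neutral ballI) (simp only: C[OF s v] \<open>C s = 0\<close> mult_zero_left)
    then show False using M_N[OF s v v] by simp
  qed
  have "bond_indices D (arcs G) \<noteq> {}" by (intro index_nonempty D_pos)
  then obtain u where u: "u \<in> bond_indices D (arcs G)" by blast
  \<comment> \<open>Testing with \<open>a\<close> at every vertex gives 1 on the first network. On
    the second it gives the product of all \<open>C s\<close> times the diagonal entries of
    \<open>K e K' e\<close> at \<open>u e\<close>, which are 1.\<close>
  have "(\<Sum>w\<in>bond_indices D (arcs G). \<Prod>s\<in>verts G. \<Sum>i<d s. a s (restrict u (incident G s)) i * A s i (restrict w (incident G s)))
     = (\<Sum>w\<in>bond_indices D (arcs G). if w = u then 1 else 0)"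
  proof (intro sum.cong refl)
    fix w assume w: "w \<in> bond_indices D (arcs G)"
    have "(\<Prod>s\<in>verts G. \<Sum>i<d s. a s (restrict u (incident G s)) i * A s i (restrict w (incident G s)))
      = (\<Prod>s\<in>verts G. if restrict u (incident G s) = restrict w (incident G s) then 1 else 0)"
      using dual_A[OF _ restrict_bond_indices[OF u incident_subset] restrict_bond_indices[OF w incident_subset]]
      by (intro prod.cong refl) (simp only: transfer_def)
    also have "\<dots> = (if w = u then 1 else 0)"
    proof (cases "w = u")
      case False
      then obtain e where e: "e \<in> arcs G" "w e \<noteq> u e"
        using u w by (meson PiE_ext)
      have "e \<in> incident G (tail G e)" "tail G e \<in> verts G" using e by (auto simp: incident_def)
      moreover from this have "restrict u (incident G (tail G e)) \<noteq> restrict w (incident G (tail G e))"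
        using e by (metis restrict_apply')
      ultimately have "(\<Prod>s\<in>verts G. if restrict u (incident G s) = restrict w (incident G s) then 1 else 0 :: complex) = 0"
        by (intro prod_zero) auto
      then show ?thesis using False by simp
    qed simp
    finally show "(\<Prod>s\<in>verts G. \<Sum>i<d s. a s (restrict u (incident G s)) i * A s i (restrict w (incident G s)))
      = (if w = u then 1 else 0)" .
  qed
  also have "\<dots> = 1" using u by (simp add: finite_index)
  finally have "1 = (\<Sum>w\<in>bond_indices D' (arcs G). \<Prod>s\<in>verts G. M s (restrict u (incident G s)) (restrict w (incident G s)))"
    unfolding contract_eq by (simp only: transfer_def)
  also have "\<dots> = (\<Sum>w\<in>bond_indices D' (arcs G). (\<Prod>s\<in>verts G. C s) * (\<Prod>e\<in>arcs G. K e (u e) (w e) * K' e (w e) (u e)))"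
  proof (intro sum.cong refl)
    fix w assume w: "w \<in> bond_indices D' (arcs G)"
    have "(\<Prod>s\<in>verts G. M s (restrict u (incident G s)) (restrict w (incident G s)))
      = (\<Prod>s\<in>verts G. C s * (\<Prod>e\<in>incident G s. k s e (u e) (w e)))"
      by (intro prod.cong refl)
        (simp add: C[OF _ restrict_bond_indices[OF u incident_subset] restrict_bond_indices[OF w incident_subset]])
    also have "\<dots> = (\<Prod>s\<in>verts G. C s) * (\<Prod>e\<in>arcs G. k (tail G e) e (u e) (w e) * k (head G e) e (u e) (w e))"
      by (simp add: prod.distrib prod_incident)
    also have "(\<Prod>e\<in>arcs G. k (tail G e) e (u e) (w e) * k (head G e) e (u e) (w e))
      = (\<Prod>e\<in>arcs G. K e (u e) (w e) * K' e (w e) (u e))"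
      using no_loops by (intro prod.cong refl) (auto simp: k_def)
    finally show "(\<Prod>s\<in>verts G. M s (restrict u (incident G s)) (restrict w (incident G s)))
      = (\<Prod>s\<in>verts G. C s) * (\<Prod>e\<in>arcs G. K e (u e) (w e) * K' e (w e) (u e))" .
  qed
  also have "\<dots> = (\<Prod>s\<in>verts G. C s) * (\<Sum>w\<in>bond_indices D' (arcs G). \<Prod>e\<in>arcs G. K e (u e) (w e) * K' e (w e) (u e))"
    by (simp add: sum_distrib_left)
  also have "(\<Sum>w\<in>bond_indices D' (arcs G). \<Prod>e\<in>arcs G. K e (u e) (w e) * K' e (w e) (u e))
    = (\<Prod>e\<in>arcs G. \<Sum>c<D' e. K e (u e) c * K' e c (u e))"
    by (rule prod_sum_PiE[symmetric]) auto
  also have "\<dots> = 1"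
  proof (intro prod.neutral ballI)
    fix e assume e: "e \<in> arcs G"
    then have "u e < D e" using PiE_mem[OF u e] by simp
    then show "(\<Sum>c<D' e. K e (u e) c * K' e c (u e)) = 1" using K1[OF e] by simp
  qed
  finally have "(\<Prod>s\<in>verts G. C s) = 1" by simp
  from that[of K K' C, OF K1 K2 C[unfolded k_def] C0 this] show thesis .
qed

end

subsection \<open>Gauge transformations\<close>

lemma mult_eq_one_mat_iff:
  fixes X Y :: "'a::semiring_1 mat"
  assumes "X \<in> carrier_mat n n" "Y \<in> carrier_mat n n"
  shows "X * Y = 1\<^sub>m n \<longleftrightarrow> (\<forall>i<n. \<forall>j<n. (\<Sum>k<n. X $$ (i, k) * Y $$ (k, j)) = (if i = j then 1 else 0))"
proof -
  have "(X * Y) $$ (i, j) = (\<Sum>k<n. X $$ (i, k) * Y $$ (k, j))" if "i < n" "j < n" for i j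
    using that assms by (simp add: scalar_prod_def atLeast0LessThan)
  then show ?thesis using assms by (auto simp: mat_eq_iff)
qed

text \<open>Lets the term \<open>the (mat_inverse (Z e))\<close> in \<open>gauge_action\<close> be
  evaluated from an explicit two-sided inverse.\<close>

lemma mat_inverse_eq_Some:
  fixes X :: "'a::field mat"
  assumes X: "X \<in> carrier_mat n n" and Y: "Y \<in> carrier_mat n n" and XY: "X * Y = 1\<^sub>m n" and YX: "Y * X = 1\<^sub>m n"
  shows "mat_inverse X = Some Y"
proof (cases "mat_inverse X")
  case None
  have "X \<in> Units (ring_mat TYPE('a) n ())"
    using assms unfolding Units_def ring_mat_def by auto
  then show ?thesis using mat_inverse(1)[OF X None, of "()"] by simp
next
  case (Some W)
  have W: "X * W = 1\<^sub>m n" "W * X = 1\<^sub>m n" "W \<in> carrier_mat n n"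
    using mat_inverse(2)[OF X Some] by auto
  have "W = W * (X * Y)" using W XY by simp
  also have "\<dots> = (W * X) * Y" by (rule assoc_mult_mat[OF W(3) X Y, symmetric])
  also have "\<dots> = Y" using W Y by simp
  finally show ?thesis using Some by simp
qed

lemma invertible_mat_inverse:
  fixes X :: "'a::field mat"
  assumes X: "X \<in> carrier_mat m n" and inv: "invertible_mat X"
  obtains Y where "m = n" "mat_inverse X = Some Y" "Y \<in> carrier_mat n n" "X * Y = 1\<^sub>m n" "Y * X = 1\<^sub>m n"
proof -
  have mn: "m = n" using X inv by (auto simp: invertible_mat_def)
  obtain Y where "inverts_mat X Y" "inverts_mat Y X" using inv by (auto simp: invertible_mat_def)
  then have XY: "X * Y = 1\<^sub>m n" and YX: "Y * X = 1\<^sub>m (dim_row Y)"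
    using X mn by (auto simp: inverts_mat_def)
  \<comment> \<open>\<open>invertible_mat\<close> does not state the size of the inverse; it is read
    off from the two identity products.\<close>
  have "dim_col Y = n" using arg_cong[OF XY, of dim_col] by simp
  moreover have "dim_row Y = n" using arg_cong[OF YX, of dim_col] X by simp
  ultimately have Y: "Y \<in> carrier_mat n n" by auto
  show thesis
    using that[OF mn mat_inverse_eq_Some[OF X[unfolded mn] Y XY] Y XY] YX Y by simp
qed

section \<open>Left inverses from injectivity, and gauge invariance of the state\<close>

context simple_graph
begin

lemma injective_peps_dual:
  assumes inj: "injective_peps G d D A"
  obtains a where "\<And>s u v. \<lbrakk>s \<in> verts G; u \<in> bond_indices D (incident G s); v \<in> bond_indices D (incident G s)\<rbrakk>
      \<Longrightarrow> transfer d a A s u v = (if u = v then 1 else 0)"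
proof -
  have "\<forall>s\<in>verts G. \<exists>a. \<forall>u\<in>bond_indices D (incident G s). \<forall>v\<in>bond_indices D (incident G s).
     (\<Sum>i\<in>{..<d s}. a u i * A s i v) = (if u = v then 1 else 0)"
  proof
    fix s assume s: "s \<in> verts G"
    let ?V = "bond_indices D (incident G s)"
    show "\<exists>a. \<forall>u\<in>?V. \<forall>v\<in>?V. (\<Sum>i\<in>{..<d s}. a u i * A s i v) = (if u = v then 1 else 0)"
    proof (rule dual_family)
      show "finite ?V" by (simp add: finite_index)
      show "finite {..<d s}" by simp
      fix X v assume X: "\<And>i. i \<in> {..<d s} \<Longrightarrow> (\<Sum>v\<in>?V. A s i v * X v) = 0" and v: "v \<in> ?V"
      \<comment> \<open>Injectivity is stated on extensional functions, so \<open>X\<close> and the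
        zero vector are compared after restriction.\<close>
      have "tensor_map G d D A s (restrict X ?V) = tensor_map G d D A s (restrict (\<lambda>v. 0) ?V)"
        unfolding tensor_map_def virtual_indices_def using X by (intro restrict_ext) simp
      moreover have "inj_on (tensor_map G d D A s) (?V \<rightarrow>\<^sub>E UNIV)"
        using inj s by (simp add: injective_peps_def virtual_indices_def)
      ultimately have "restrict X ?V = restrict (\<lambda>v. 0) ?V"
        by (elim inj_onD) auto
      from fun_cong[OF this, of v] show "X v = 0" using v by simp
    qed
  qed
  from bchoice[OF this] obtain a where a: "\<forall>s\<in>verts G. \<forall>u\<in>bond_indices D (incident G s). \<forall>v\<in>bond_indices D (incident G s).
     (\<Sum>i\<in>{..<d s}. a s u i * A s i v) = (if u = v then 1 else 0)" ..
  show thesis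
    by (rule that[of a], unfold transfer_def, rule a[rule_format])
qed

text \<open>Once all gauge actions are expanded, summing over the bond index of each edge multiplies
  \<open>Z e\<close> by its inverse, and the resulting deltas glue the virtual indices of
  \<open>A\<close> along the edges.\<close>

lemma gauge_same_state:
  assumes g: "is_gauge G d D A D' B Z"
  shows "peps_state G d D A = peps_state G d D' B"
  unfolding peps_state_def
proof (rule restrict_ext)
  fix p assume p: "p \<in> Pi\<^sub>E (verts G) (\<lambda>s. {..<d s})"
  define W where "W e = the (mat_inverse (Z e))" for e
  have WZ: "(\<Sum>c<D' e. Z e $$ (c, y) * W e $$ (x, c)) = (if x = y then 1 else 0)"
    if e: "e \<in> arcs G" and x: "x < D e" and y: "y < D e" for e x y
  proof -
    have Z: "Z e \<in> carrier_mat (D' e) (D e)" "invertible_mat (Z e)"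
      using g e by (auto simp: is_gauge_def)
    obtain Y where Y: "D' e = D e" "mat_inverse (Z e) = Some Y" "Y \<in> carrier_mat (D e) (D e)" "Y * Z e = 1\<^sub>m (D e)"
      using invertible_mat_inverse[OF Z] by metis
    have "W e = Y" using Y by (simp add: W_def)
    then have "(\<Sum>c<D e. W e $$ (x, c) * Z e $$ (c, y)) = (if x = y then 1 else 0)"
      using mult_eq_one_mat_iff[OF Y(3), of "Z e"] Z Y x y by simp
    then show ?thesis by (simp add: Y(1) mult.commute)
  qed
  define h where "h s e c x = (if tail G e = s then Z e $$ (c, x) else W e $$ (x, c))" for s e c x
  define VV where "VV = Pi\<^sub>E (verts G) (\<lambda>s. bond_indices D (incident G s))"
  have finVV: "finite VV" unfolding VV_def by (rule finite_PiE) (simp_all add: finite_index)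
  have B: "B s (p s) (restrict w (incident G s))
      = (\<Sum>v\<in>bond_indices D (incident G s). (\<Prod>e\<in>incident G s. h s e (w e) (v e)) * A s (p s) v)"
    if s: "s \<in> verts G" and w: "w \<in> bond_indices D' (arcs G)" for s w
  proof -
    have "p s < d s" using PiE_mem[OF p s] by simp
    then have "B s (p s) (restrict w (incident G s)) = gauge_action G D Z A s (p s) (restrict w (incident G s))"
      using g s restrict_bond_indices[OF w incident_subset] unfolding is_gauge_def virtual_indices_def by blast
    also have "\<dots> = (\<Sum>v\<in>bond_indices D (incident G s). (\<Prod>e\<in>incident G s. h s e (w e) (v e)) * A s (p s) v)"
      unfolding gauge_action_def virtual_indices_def h_def W_def
      by (intro sum.cong arg_cong2[where f = "(*)"] prod.cong refl) simp
    finally show ?thesis .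
  qed
  have "(\<Sum>w\<in>bond_indices D' (arcs G). \<Prod>s\<in>verts G. B s (p s) (restrict w (incident G s)))
     = (\<Sum>w\<in>bond_indices D' (arcs G). \<Prod>s\<in>verts G. \<Sum>v\<in>bond_indices D (incident G s).
          (\<Prod>e\<in>incident G s. h s e (w e) (v e)) * A s (p s) v)"
    by (intro sum.cong prod.cong refl B)
  \<comment> \<open>\<open>V\<close> chooses virtual indices independently at each vertex, so at
    this stage the two ends of an edge may carry different values.\<close>
  also have "\<dots> = (\<Sum>w\<in>bond_indices D' (arcs G). \<Sum>V\<in>VV.
          \<Prod>s\<in>verts G. (\<Prod>e\<in>incident G s. h s e (w e) (V s e)) * A s (p s) (V s))"
    unfolding VV_def by (intro sum.cong refl prod_sum_PiE) (simp_all add: finite_index)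
  also have "\<dots> = (\<Sum>V\<in>VV. \<Sum>w\<in>bond_indices D' (arcs G).
          \<Prod>s\<in>verts G. (\<Prod>e\<in>incident G s. h s e (w e) (V s e)) * A s (p s) (V s))"
    by (rule sum.swap)
  also have "\<dots> = (\<Sum>V\<in>VV. if \<forall>e\<in>arcs G. V (tail G e) e = V (head G e) e
          then \<Prod>s\<in>verts G. A s (p s) (V s) else 0)"
  proof (rule sum.cong[OF refl])
    fix V assume V: "V \<in> VV"
    have Vlt: "V s e < D e" if "e \<in> incident G s" for s e
    proof -
      have "V s \<in> bond_indices D (incident G s)"
        using PiE_mem[OF V[unfolded VV_def] in_incident_vert[OF that]] .
      from PiE_mem[OF this that] show ?thesis by simp
    qed
    have "(\<Sum>w\<in>bond_indices D' (arcs G). \<Prod>s\<in>verts G. (\<Prod>e\<in>incident G s. h s e (w e) (V s e)) * A s (p s) (V s))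
      = (\<Sum>w\<in>bond_indices D' (arcs G). \<Prod>e\<in>arcs G. Z e $$ (w e, V (tail G e) e) * W e $$ (V (head G e) e, w e))
        * (\<Prod>s\<in>verts G. A s (p s) (V s))"
      unfolding sum_distrib_right prod.distrib[where h = "\<lambda>s. A s (p s) (V s)"] prod_incident
      using no_loops by (intro sum.cong arg_cong2[where f = "(*)"] prod.cong refl) (simp_all add: h_def)
    also have "(\<Sum>w\<in>bond_indices D' (arcs G). \<Prod>e\<in>arcs G. Z e $$ (w e, V (tail G e) e) * W e $$ (V (head G e) e, w e))
      = (\<Prod>e\<in>arcs G. \<Sum>c<D' e. Z e $$ (c, V (tail G e) e) * W e $$ (V (head G e) e, c))"
      by (rule prod_sum_PiE[symmetric]) simp_all
    also have "\<dots> = (\<Prod>e\<in>arcs G. if V (tail G e) e = V (head G e) e then 1 else 0)"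
    proof (intro prod.cong refl)
      fix e assume e: "e \<in> arcs G"
      then have "V (tail G e) e < D e" "V (head G e) e < D e"
        by (auto intro!: Vlt simp: incident_def)
      then show "(\<Sum>c<D' e. Z e $$ (c, V (tail G e) e) * W e $$ (V (head G e) e, c))
        = (if V (tail G e) e = V (head G e) e then 1 else 0)"
        using WZ[OF e, of "V (head G e) e" "V (tail G e) e"] by (simp add: eq_commute)
    qed
    also have "\<dots> = (if \<forall>e\<in>arcs G. V (tail G e) e = V (head G e) e then 1 else 0)"
      by (auto intro!: prod_zero)
    finally show "(\<Sum>w\<in>bond_indices D' (arcs G). \<Prod>s\<in>verts G. (\<Prod>e\<in>incident G s. h s e (w e) (V s e)) * A s (p s) (V s))
      = (if \<forall>e\<in>arcs G. V (tail G e) e = V (head G e) e then \<Prod>s\<in>verts G. A s (p s) (V s) else 0)"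
      by simp
  qed
  also have "\<dots> = (\<Sum>V\<in>{V \<in> VV. \<forall>e\<in>arcs G. V (tail G e) e = V (head G e) e}. \<Prod>s\<in>verts G. A s (p s) (V s))"
    using finVV by (rule sum.inter_filter[symmetric])
  also have "\<dots> = (\<Sum>w\<in>bond_indices D (arcs G). \<Prod>s\<in>verts G. A s (p s) (restrict w (incident G s)))"
  \<comment> \<open>Families whose values agree at both ends of every edge correspond to assignments
    of one value per edge.\<close>
  proof (rule sum.reindex_bij_witness[of _ "\<lambda>w. \<lambda>s\<in>verts G. restrict w (incident G s)" "\<lambda>V. \<lambda>e\<in>arcs G. V (tail G e) e"])
    fix V assume "V \<in> {V \<in> VV. \<forall>e\<in>arcs G. V (tail G e) e = V (head G e) e}"
    then have V: "V \<in> Pi\<^sub>E (verts G) (\<lambda>s. bond_indices D (incident G s))"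
      and cons: "\<And>e. e \<in> arcs G \<Longrightarrow> V (tail G e) e = V (head G e) e" by (auto simp: VV_def)
    let ?w = "\<lambda>e\<in>arcs G. V (tail G e) e"
    have Vs: "restrict ?w (incident G s) = V s" if s: "s \<in> verts G" for s
    proof
      fix e show "restrict ?w (incident G s) e = V s e"
      proof (cases "e \<in> incident G s")
        case True
        then have "e \<in> arcs G" "s = tail G e \<or> s = head G e" by (auto simp: incident_def)
        then have "?w e = V s e" using cons[of e] by auto
        then show ?thesis using True by simp
      next
        case False
        then show ?thesis using PiE_arb[OF PiE_mem[OF V s] False] by simp
      qed
    qed
    show "(\<lambda>s\<in>verts G. restrict ?w (incident G s)) = V"
    proof
      fix s show "(\<lambda>s\<in>verts G. restrict ?w (incident G s)) s = V s"
      proof (cases "s \<in> verts G")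
        case True
        then show ?thesis by (simp only: restrict_apply' Vs)
      next
        case False
        then show ?thesis unfolding restrict_apply PiE_arb[OF V False] by simp
      qed
    qed
    show "?w \<in> bond_indices D (arcs G)"
      unfolding restrict_PiE_iff
    proof
      fix e assume e: "e \<in> arcs G"
      then have "V (tail G e) \<in> bond_indices D (incident G (tail G e))" using PiE_mem[OF V] by simp
      moreover have "e \<in> incident G (tail G e)" using e by (simp add: incident_def)
      ultimately show "V (tail G e) e \<in> {..<D e}" by (rule PiE_mem)
    qed
    show "(\<Prod>s\<in>verts G. A s (p s) (restrict ?w (incident G s))) = (\<Prod>s\<in>verts G. A s (p s) (V s))"
      by (intro prod.cong refl) (simp only: Vs)
  next
    fix w assume w: "w \<in> bond_indices D (arcs G)"
    let ?V = "\<lambda>s\<in>verts G. restrict w (incident G s)"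
    have V: "?V (tail G e) e = w e" "?V (head G e) e = w e" if "e \<in> arcs G" for e
      using that by (simp_all add: incident_def)
    show "(\<lambda>e\<in>arcs G. ?V (tail G e) e) = w"
    proof
      fix e show "(\<lambda>e\<in>arcs G. ?V (tail G e) e) e = w e"
      proof (cases "e \<in> arcs G")
        case True
        then show ?thesis by (simp only: restrict_apply'[of e "arcs G"] V)
      next
        case False
        then show ?thesis unfolding restrict_apply[of _ "arcs G"] PiE_arb[OF w False] by simp
      qed
    qed
    have "?V \<in> VV"
      unfolding VV_def
      by (rule restrict_PiE_iff[THEN iffD2], rule ballI, rule restrict_bond_indices[OF w incident_subset])
    then show "?V \<in> {V \<in> VV. \<forall>e\<in>arcs G. V (tail G e) e = V (head G e) e}"
      using V by (intro CollectI conjI ballI) (simp_all only:)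
  qed
  finally show "(\<Sum>w\<in>bond_indices D (arcs G). \<Prod>s\<in>verts G. A s (p s) (restrict w (incident G s)))
     = (\<Sum>w\<in>bond_indices D' (arcs G). \<Prod>s\<in>verts G. B s (p s) (restrict w (incident G s)))" ..
qed

end

section \<open>Existence of a gauge transformation on a connected graph\<close>

context equal_state_peps
begin

lemma connected_gauge_exists:
  assumes "Digraph_Component.connected G"
  shows "gauge_related G d D A D' B"
proof (rule gauge_factorization)
  fix K K' C
  assume KK': "\<And>e x x'. \<lbrakk>e \<in> arcs G; x < D e; x' < D e\<rbrakk> \<Longrightarrow> (\<Sum>c<D' e. K e x c * K' e c x') = (if x = x' then 1 else 0)"
    and K'K: "\<And>e c c'. \<lbrakk>e \<in> arcs G; c < D' e; c' < D' e\<rbrakk> \<Longrightarrow> (\<Sum>x<D e. K' e c x * K e x c') = (if c = c' then 1 else 0)"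
    and MC: "\<And>s u w. \<lbrakk>s \<in> verts G; u \<in> bond_indices D (incident G s); w \<in> bond_indices D' (incident G s)\<rbrakk> \<Longrightarrow>
      M s u w = C s * (\<Prod>e\<in>incident G s. if tail G e = s then K e (u e) (w e) else K' e (w e) (u e))"
    and C0: "\<And>s. s \<in> verts G \<Longrightarrow> C s \<noteq> 0"
    and C1: "(\<Prod>s\<in>verts G. C s) = 1"
  obtain z where z0: "\<And>e. z e \<noteq> 0" and zC: "\<And>s. s \<in> verts G \<Longrightarrow> divergence z s = C s"
    using connected_realizable[OF assms C0 C1] unfolding realizable_def by blast
  have DD': "D' e = D e" if e: "e \<in> arcs G" for e
  proof -
    \<comment> \<open>The bond dimensions agree because \<open>K e K' e\<close> and
      \<open>K' e K e\<close> are identity matrices with the same trace.\<close>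
    have "of_nat (D e) = (\<Sum>x<D e. \<Sum>c<D' e. K e x c * K' e c x)" using KK'[OF e] by simp
    also have "\<dots> = (\<Sum>c<D' e. \<Sum>x<D e. K' e c x * K e x c)" by (subst sum.swap) (simp add: mult.commute)
    also have "\<dots> = of_nat (D' e)" using K'K[OF e] by simp
    finally show ?thesis using of_nat_eq_iff[where 'a = complex] by simp
  qed
  \<comment> \<open>\<open>K\<close> appears transposed since \<open>M s v w\<close> takes the index
    of \<open>A\<close> first. The scalars \<open>z e\<close> have divergence \<open>C s\<close>, so
    they absorb the vertex scalars.\<close>
  define Z where "Z e = mat (D' e) (D e) (\<lambda>(w, v). z e * K e v w)" for e
  define W where "W e = mat (D e) (D' e) (\<lambda>(v, w). inverse (z e) * K' e w v)" for e
  have carr: "Z e \<in> carrier_mat (D' e) (D' e)" "W e \<in> carrier_mat (D' e) (D' e)" if "e \<in> arcs G" for e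
    using DD'[OF that] by (simp_all add: Z_def W_def)
  have ZW: "Z e * W e = 1\<^sub>m (D' e)" if e: "e \<in> arcs G" for e
    unfolding mult_eq_one_mat_iff[OF carr[OF e]]
  proof (intro allI impI)
    fix i j assume ij: "i < D' e" "j < D' e"
    have "(\<Sum>k<D' e. Z e $$ (i, k) * W e $$ (k, j)) = (\<Sum>k<D e. K' e j k * K e k i)"
      unfolding DD'[OF e] using ij DD'[OF e] z0[of e] by (intro sum.cong refl) (simp add: Z_def W_def)
    then show "(\<Sum>k<D' e. Z e $$ (i, k) * W e $$ (k, j)) = (if i = j then 1 else 0)"
      using K'K[OF e ij(2,1)] by auto
  qed
  have WZ: "W e * Z e = 1\<^sub>m (D' e)" if e: "e \<in> arcs G" for e
    unfolding mult_eq_one_mat_iff[OF carr(2,1)[OF e]]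
  proof (intro allI impI)
    fix i j assume ij: "i < D' e" "j < D' e"
    have "(\<Sum>k<D' e. W e $$ (i, k) * Z e $$ (k, j)) = (\<Sum>k<D' e. K e j k * K' e k i)"
      using ij DD'[OF e] z0[of e] by (intro sum.cong refl) (simp add: Z_def W_def)
    then show "(\<Sum>k<D' e. W e $$ (i, k) * Z e $$ (k, j)) = (if i = j then 1 else 0)"
      using KK'[OF e, of j i] ij DD'[OF e] by auto
  qed
  have inv: "mat_inverse (Z e) = Some (W e)" if e: "e \<in> arcs G" for e
    by (rule mat_inverse_eq_Some[OF carr[OF e] ZW[OF e] WZ[OF e]])
  have "is_gauge G d D A D' B Z"
    unfolding is_gauge_def
  proof (intro conjI ballI allI impI)
    fix e assume e: "e \<in> arcs G"
    show "Z e \<in> carrier_mat (D' e) (D e)" by (simp add: Z_def)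
    show "invertible_mat (Z e)"
      using carr[OF e] ZW[OF e] WZ[OF e]
      by (auto simp: invertible_mat_def inverts_mat_def intro!: exI[of _ "W e"])
  next
    fix s i w assume s: "s \<in> verts G" and i: "i < d s" and w': "w \<in> virtual_indices G D' s"
    then have w: "w \<in> bond_indices D' (incident G s)" by (simp only: virtual_indices_def)
    have "gauge_action G D Z A s i w = (\<Sum>v\<in>bond_indices D (incident G s). A s i v * M s v w)"
      unfolding gauge_action_def virtual_indices_def
    proof (intro sum.cong refl)
      fix v assume v: "v \<in> bond_indices D (incident G s)"
      have "(\<Prod>e\<in>incident G s. if tail G e = s then Z e $$ (w e, v e) else the (mat_inverse (Z e)) $$ (v e, w e))
        = (\<Prod>e\<in>incident G s. (if tail G e = s then z e else inverse (z e)) *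
            (if tail G e = s then K e (v e) (w e) else K' e (w e) (v e)))"
      proof (intro prod.cong refl)
        fix e assume e: "e \<in> incident G s"
        have "w e < D' e" "v e < D e" using PiE_mem[OF w e] PiE_mem[OF v e] by auto
        then show "(if tail G e = s then Z e $$ (w e, v e) else the (mat_inverse (Z e)) $$ (v e, w e))
          = (if tail G e = s then z e else inverse (z e)) *
            (if tail G e = s then K e (v e) (w e) else K' e (w e) (v e))"
          using inv[of e] e incident_subset[of s] by (auto simp: Z_def W_def)
      qed
      also have "\<dots> = divergence z s * (\<Prod>e\<in>incident G s. if tail G e = s then K e (v e) (w e) else K' e (w e) (v e))"
        unfolding prod.distrib divergence_def ..
      also have "\<dots> = M s v w" unfolding MC[OF s v w] zC[OF s] ..
      finally show "(\<Prod>e\<in>incident G s. if tail G e = s then Z e $$ (w e, v e) else the (mat_inverse (Z e)) $$ (v e, w e)) * A s i v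
        = A s i v * M s v w" by (simp only: mult.commute)
    qed
    then show "B s i w = gauge_action G D Z A s i w" using recover_B[OF s w i] by simp
  qed
  then show ?thesis unfolding gauge_related_def by blast
qed

end

section \<open>Uniqueness of the gauge matrices up to scalars\<close>

context simple_graph
begin

text \<open>The transfer matrix at the tail of \<open>e\<close> depends only on the tensors, and
  every gauge writes it as a product of its edge matrices. Freezing the indices of the other edges
  compares \<open>Z e\<close> with \<open>Z' e\<close> entrywise.\<close>

lemma gauge_unique:
  assumes dual: "\<And>s u v. \<lbrakk>s \<in> verts G; u \<in> bond_indices D (incident G s); v \<in> bond_indices D (incident G s)\<rbrakk>
      \<Longrightarrow> transfer d a A s u v = (if u = v then 1 else 0)"
    and pos: "\<And>e. e \<in> arcs G \<Longrightarrow> 0 < D e"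
    and Z: "is_gauge G d D A D' B Z" and Z': "is_gauge G d D A D' B Z'" and e: "e \<in> arcs G"
  obtains c :: complex where "c \<noteq> 0" "Z' e = c \<cdot>\<^sub>m Z e"
proof -
  define s where "s = tail G e"
  have s: "s \<in> verts G" and es: "e \<in> incident G s" using e by (auto simp: s_def incident_def)
  define h where "h X f c x = (if tail G f = s then X f $$ (c, x) else the (mat_inverse (X f)) $$ (x, c))"
    for X :: "'e \<Rightarrow> complex mat" and f c x
  have M: "transfer d a B s u w = (\<Prod>f\<in>incident G s. h X f (w f) (u f))"
    if X: "is_gauge G d D A D' B X" and u: "u \<in> bond_indices D (incident G s)" and w: "w \<in> bond_indices D' (incident G s)"
    for X u w
  proof -
    have "transfer d a B s u w
      = (\<Sum>i<d s. a s u i * (\<Sum>v\<in>bond_indices D (incident G s). (\<Prod>f\<in>incident G s. h X f (w f) (v f)) * A s i v))"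
      unfolding transfer_def
    proof (intro sum.cong refl arg_cong2[where f = "(*)"])
      fix i assume "i \<in> {..<d s}"
      then have "B s i w = gauge_action G D X A s i w"
        using X s w unfolding is_gauge_def virtual_indices_def by blast
      then show "B s i w = (\<Sum>v\<in>bond_indices D (incident G s). (\<Prod>f\<in>incident G s. h X f (w f) (v f)) * A s i v)"
        unfolding gauge_action_def virtual_indices_def h_def .
    qed
    also have "\<dots> = (\<Sum>v\<in>bond_indices D (incident G s). (\<Prod>f\<in>incident G s. h X f (w f) (v f)) * transfer d a A s u v)"
      unfolding transfer_def sum_distrib_left by (subst sum.swap) (simp only: mult.left_commute)
    also have "\<dots> = (\<Sum>v\<in>bond_indices D (incident G s). if u = v then \<Prod>f\<in>incident G s. h X f (w f) (v f) else 0)"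
      by (intro sum.cong refl) (simp add: dual[OF s u])
    also have "\<dots> = (\<Prod>f\<in>incident G s. h X f (w f) (u f))"
      using u by (subst sum.delta') (simp_all add: finite_index)
    finally show ?thesis .
  qed
  have ex: "\<exists>c<D' f. \<exists>x<D f. h X f c x \<noteq> 0" if X: "is_gauge G d D A D' B X" and f: "f \<in> arcs G" for X f
  proof -
    have Xf: "X f \<in> carrier_mat (D' f) (D f)" "invertible_mat (X f)" using X f by (auto simp: is_gauge_def)
    obtain Y where Y: "D' f = D f" "mat_inverse (X f) = Some Y" "Y \<in> carrier_mat (D f) (D f)" "Y * X f = 1\<^sub>m (D f)"
      using invertible_mat_inverse[OF Xf] by metis
    have "(\<Sum>k<D f. Y $$ (0, k) * X f $$ (k, 0)) = 1"
      using mult_eq_one_mat_iff[OF Y(3), of "X f"] Xf Y pos[OF f] by auto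
    then have "(\<Sum>k<D f. Y $$ (0, k) * X f $$ (k, 0)) \<noteq> 0" by simp
    then obtain k where "k < D f" "Y $$ (0, k) * X f $$ (k, 0) \<noteq> 0"
      by (meson lessThan_iff sum.neutral)
    then show ?thesis
      using Y(1,2) pos[OF f] by (intro exI[of _ k] conjI exI[of _ 0]) (auto simp: h_def)
  qed
  have "\<forall>f\<in>incident G s. \<exists>cx. fst cx < D' f \<and> snd cx < D f \<and> h Z f (fst cx) (snd cx) \<noteq> 0"
  proof
    fix f assume "f \<in> incident G s"
    then obtain c x where "c < D' f" "x < D f" "h Z f c x \<noteq> 0" using ex[OF Z] incident_subset by blast
    then show "\<exists>cx. fst cx < D' f \<and> snd cx < D f \<and> h Z f (fst cx) (snd cx) \<noteq> 0"
      by (intro exI[of _ "(c, x)"]) simp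
  qed
  from bchoice[OF this] obtain cx where cx:
    "\<forall>f\<in>incident G s. fst (cx f) < D' f \<and> snd (cx f) < D f \<and> h Z f (fst (cx f)) (snd (cx f)) \<noteq> 0" ..
  \<comment> \<open>The positions \<open>cx\<close> are nonzero entries for \<open>Z\<close> only,
    so \<open>R Z \<noteq> 0\<close> is immediate, whereas \<open>R Z' \<noteq> 0\<close> follows
    from \<open>eq\<close> at a nonzero entry of \<open>Z e\<close>. The proportionality constant is
    \<open>R Z / R Z'\<close>.\<close>
  define R where "R X = (\<Prod>f\<in>incident G s - {e}. h X f (fst (cx f)) (snd (cx f)))" for X
  have eq: "Z e $$ (w, v) * R Z = Z' e $$ (w, v) * R Z'" if w: "w < D' e" and v: "v < D e" for w v
  proof -
    define u where "u = (\<lambda>f\<in>incident G s. if f = e then v else snd (cx f))"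
    define y where "y = (\<lambda>f\<in>incident G s. if f = e then w else fst (cx f))"
    have u: "u \<in> bond_indices D (incident G s)" and y: "y \<in> bond_indices D' (incident G s)"
      unfolding u_def y_def restrict_PiE_iff using cx w v by auto
    have "(\<Prod>f\<in>incident G s. h X f (y f) (u f)) = X e $$ (w, v) * R X" for X
    proof -
      have "(\<Prod>f\<in>incident G s - {e}. h X f (y f) (u f)) = R X"
        unfolding R_def by (intro prod.cong refl) (auto simp: u_def y_def)
      moreover have "h X e (y e) (u e) = X e $$ (w, v)"
        using es by (simp add: h_def u_def y_def s_def)
      ultimately show ?thesis using es by (simp add: prod.remove[of _ e])
    qed
    then show ?thesis using M[OF Z u y] M[OF Z' u y] by simp
  qed
  have R0: "R Z \<noteq> 0" unfolding R_def using cx by auto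
  obtain w v where wv: "w < D' e" "v < D e" "h Z e w v \<noteq> 0" using ex[OF Z e] by blast
  have "R Z' \<noteq> 0"
    using eq[OF wv(1,2)] wv(3) R0 by (auto simp: h_def s_def)
  then have "Z' e $$ (w, v) = R Z / R Z' * Z e $$ (w, v)" if "w < D' e" "v < D e" for w v
    using eq[OF that] by (simp add: field_simps)
  moreover have "Z e \<in> carrier_mat (D' e) (D e)" "Z' e \<in> carrier_mat (D' e) (D e)"
    using Z Z' e by (auto simp: is_gauge_def)
  ultimately have "Z' e = (R Z / R Z') \<cdot>\<^sub>m Z e" by (intro eq_matI) auto
  then show thesis using that[of "R Z / R Z'"] R0 \<open>R Z' \<noteq> 0\<close> by simp
qed

end

text \<open>Connectedness is required for the existence of a gauge: scaling the tensors of two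
  components by mutually inverse factors preserves the state, yet a gauge preserves the state of
  each component. Zero-dimensional bonds are excluded because a single one makes the state vanish
  whatever the dimensions of the other bonds.\<close>

theorem theorem2p7:
  fixes G :: "('v, 'e) pre_digraph"
    and d :: "'v \<Rightarrow> nat"
    and D D' :: "'e \<Rightarrow> nat"
    and A B :: "'v \<Rightarrow> 'e tensor"
  assumes finite_graph: "fin_digraph G"
    and no_self_loops: "loopfree_digraph G"
    and no_double_edges: "inj_on (\<lambda>e. {tail G e, head G e}) (arcs G)"
    and bond_nonzero: "\<forall>e\<in>arcs G. 0 < D e \<and> 0 < D' e"
    and injective_A: "injective_peps G d D A"
    and injective_B: "injective_peps G d D' B"
  shows "(Digraph_Component.connected G \<longrightarrow>
            (peps_state G d D A = peps_state G d D' B \<longleftrightarrow> gauge_related G d D A D' B)) \<and>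
         (gauge_related G d D A D' B \<longrightarrow> peps_state G d D A = peps_state G d D' B) \<and>
         (\<forall>Z Z'. is_gauge G d D A D' B Z \<and> is_gauge G d D A D' B Z' \<longrightarrow>
            (\<forall>e\<in>arcs G. \<exists>c::complex. c \<noteq> 0 \<and> Z' e = c \<cdot>\<^sub>m Z e))"
proof -
  interpret fin_digraph G by (rule finite_graph)
  interpret loopfree_digraph G by (rule no_self_loops)
  interpret simple_graph G by unfold_locales (rule no_double_edges)
  obtain a where a: "\<And>s u v. \<lbrakk>s \<in> verts G; u \<in> bond_indices D (incident G s); v \<in> bond_indices D (incident G s)\<rbrakk>
      \<Longrightarrow> transfer d a A s u v = (if u = v then 1 else 0)"
    using injective_peps_dual[OF injective_A] by blast
  obtain b where b: "\<And>s u v. \<lbrakk>s \<in> verts G; u \<in> bond_indices D' (incident G s); v \<in> bond_indices D' (incident G s)\<rbrakk>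
      \<Longrightarrow> transfer d b B s u v = (if u = v then 1 else 0)"
    using injective_peps_dual[OF injective_B] by blast
  have same: "peps_state G d D A = peps_state G d D' B" if "gauge_related G d D A D' B"
    using that gauge_same_state unfolding gauge_related_def by blast
  moreover have "gauge_related G d D A D' B"
    if "Digraph_Component.connected G" "peps_state G d D A = peps_state G d D' B"
  proof -
    interpret equal_state_peps G d D D' A B a b
      by unfold_locales (use bond_nonzero a b that(2) in auto)
    show ?thesis by (rule connected_gauge_exists[OF that(1)])
  qed
  moreover have "\<exists>c::complex. c \<noteq> 0 \<and> Z' e = c \<cdot>\<^sub>m Z e"
    if "is_gauge G d D A D' B Z" "is_gauge G d D A D' B Z'" "e \<in> arcs G" for Z Z' e
    using gauge_unique[OF a _ that] bond_nonzero by blast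
  ultimately show ?thesis by blast
qed

end
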